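(* Let $q>2$ be a prime power, $m\ge 2$ and $0\le \ell\le m-1$. Then the $\lambda$-constacyclic code $\mathcal{C}_{(q,m,\ell)}$ over $\mathrm{GF}(q)$ has length $(q^m-1)/(q-1)$, dimension $$k=\frac{q^m-1}{q-1}-\sum_{h=0}^{m}(-1)^h\binom{m}{h}\binom{(q-1)\ell-hq+m}{1+(q-1)\ell-hq},$$ and minimum distance $d\ge d_{(q,m,\ell)}$, where $$d_{(q,m,\ell)}=\begin{cases} 2q^\ell+1 & \text{if } m \text{ is odd and } 0\le \ell\le (m-3)/2,\\ & \text{or } m\equiv 0 \pmod 4 \text{ and } 0\le\ell\le (m-4)/2,\\ & \text{or } m\equiv 2\pmod 4 \text{ and } 0\le \ell\le (m-6)/2,\\ q^{(m-4)/2}+1 & \text{if } m\equiv 2\pmod 4 \text{ and } (m-4)/2\le\ell\le (m+2)/2,\\ q^{(m-2)/2}+1 & \text{if } m\equiv 0\pmod 4 \text{ and } \ell\in\{(m-2)/2,\,m/2\},\\ q^{(m-1)/2}+1 & \text{if } m \text{ is odd and } \ell=(m-1)/2,\\ (q-1)q^{m-1-\ell}+1 & \text{otherwise.} \end{cases}$$ The dual code $\mathcal{C}_{(q,m,\ell)}^\perp$, which is $\lambda^{-1}$-constacyclic, has length $(q^m-1)/(q-1)$, dimension $$k^\perp=\sum_{h=0}^{m}(-1)^h\binom{m}{h}\binom{(q-1)\ell-hq+m}{1+(q-1)\ell-hq},$$ and minimum distance $$d^\perp\ \ge\ q^{m-1-\ell}+\frac{2(q^\ell-1)}{q-1}.$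$
   Context: Let $q>2$ be a prime power, $m\ge 2$, $N=q^m-1$, $n=N/(q-1)$, and $\mathbb{Z}_N=\{0,1,\dots,N-1\}$. For $0\le i\le q^m-1$ with $q$-adic expansion $i=\sum_{j=0}^{m-1}i_jq^j$, $0\le i_j\le q-1$, let $\mathtt{wt}_q(i)=i_0+\cdots+i_{m-1}$. For $0\le\ell\le m-1$ let $T_{(q,m,\ell)}=\{i\in\mathbb{Z}_N:\mathtt{wt}_q(i)=1+(q-1)\ell\}$; this set is closed under multiplication by $q$ modulo $N$. Let $\lambda$ be a primitive element of $\mathrm{GF}(q)$ and $\beta$ a primitive element of $\mathrm{GF}(q^m)$ with $\beta^n=\lambda$. For $\mu\in\mathrm{GF}(q)^*$, a linear code of length $n$ over $\mathrm{GF}(q)$ is $\mu$-constacyclic if, under $(c_0,\dots,c_{n-1})\mapsto\sum_jc_jx^j$, it is an ideal of $\mathrm{GF}(q)[x]/(x^n-\mu)$; its generator polynomial is the monic divisor of $x^n-\mu$ generating it. $\mathcal{C}_{(q,m,\ell)}$ is the $\lambda$-constacyclic code of length $n$ with generator polynomial $\prod_{i\in T_{(q,m,\ell)}}(x-\beta^i)$ (a divisor of $x^n-\lambda$ in $\mathrm{GF}(q)[x]$). Minimum distance is Hamming distance and $\mathcal{C}^\perp$ is the dual under the standard inner product. Convention: a binomial coefficient $\binom{a}{b}$ with $b<0$ is $0$. *)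

theory Defs
  imports
    "HOL-Computational_Algebra.Computational_Algebra"
    "HOL-Algebra.QuotRing"
    "HOL-Library.Function_Algebras"
begin

text \<open>A word of length \<open>n\<close> is a function on \<open>nat\<close> that vanishes from position \<open>n\<close> on, so that
  the words of length \<open>n\<close> form a subspace of the vector space \<open>nat \<Rightarrow> 'a\<close>.\<close>

definition words :: "nat \<Rightarrow> (nat \<Rightarrow> 'a::zero) set" where
  "words n = {c. \<forall>j\<ge>n. c j = 0}"

definition word_scale :: "'a::times \<Rightarrow> (nat \<Rightarrow> 'a) \<Rightarrow> nat \<Rightarrow> 'a" where
  "word_scale a c = (\<lambda>j. a * c j)"

lemma vector_space_word_scale:
  "vector_space (word_scale :: 'a::field \<Rightarrow> (nat \<Rightarrow> 'a) \<Rightarrow> nat \<Rightarrow> 'a)"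
  by unfold_locales (auto simp: word_scale_def fun_eq_iff algebra_simps)

definition linear_code :: "nat \<Rightarrow> (nat \<Rightarrow> 'a::field) set \<Rightarrow> bool" where
  "linear_code n C \<longleftrightarrow> C \<subseteq> words n \<and> module.subspace word_scale C"

definition code_dim :: "(nat \<Rightarrow> 'a::field) set \<Rightarrow> nat" where
  "code_dim C = vector_space.dim word_scale C"

definition hamming_dist :: "nat \<Rightarrow> (nat \<Rightarrow> 'a) \<Rightarrow> (nat \<Rightarrow> 'a) \<Rightarrow> nat" where
  "hamming_dist n u v = card {j. j < n \<and> u j \<noteq> v j}"

text \<open>For codes with a single word the infimum is over the empty set and has no meaning.\<close>

definition min_distance :: "nat \<Rightarrow> (nat \<Rightarrow> 'a) set \<Rightarrow> nat" where
  "min_distance n C = Inf {hamming_dist n u v | u v. u \<in> C \<and> v \<in> C \<and> u \<noteq> v}"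

definition dual_code :: "nat \<Rightarrow> (nat \<Rightarrow> 'a::field) set \<Rightarrow> (nat \<Rightarrow> 'a) set" where
  "dual_code n C = {v \<in> words n. \<forall>c\<in>C. (\<Sum>j<n. c j * v j) = 0}"

definition type_ring :: "'a::comm_ring_1 ring" where
  "type_ring = \<lparr>carrier = UNIV, mult = (*), one = 1, zero = 0, add = (+)\<rparr>"

definition field_embedding :: "('a::field \<Rightarrow> 'b::field) \<Rightarrow> bool" where
  "field_embedding f \<longleftrightarrow> f \<in> ring_hom type_ring type_ring"

text \<open>The ring \<open>GF(q)[x]/(x^n - \<mu>)\<close>, with residue classes as elements.\<close>

definition modulus_ideal :: "nat \<Rightarrow> 'a::field \<Rightarrow> 'a poly set" where
  "modulus_ideal n \<mu> = cgenideal type_ring (monom 1 n - [:\<mu>:])"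

definition constacyclic_ring :: "nat \<Rightarrow> 'a::field \<Rightarrow> 'a poly set ring" where
  "constacyclic_ring n \<mu> = type_ring Quot (modulus_ideal n \<mu>)"

definition residue_class :: "nat \<Rightarrow> 'a::field \<Rightarrow> 'a poly \<Rightarrow> 'a poly set" where
  "residue_class n \<mu> p = modulus_ideal n \<mu> +>\<^bsub>type_ring\<^esub> p"

definition word_poly :: "nat \<Rightarrow> (nat \<Rightarrow> 'a::field) \<Rightarrow> 'a poly" where
  "word_poly n c = (\<Sum>j<n. monom (c j) j)"

definition code_classes :: "nat \<Rightarrow> 'a::field \<Rightarrow> (nat \<Rightarrow> 'a) set \<Rightarrow> 'a poly set set" where
  "code_classes n \<mu> C = (\<lambda>c. residue_class n \<mu> (word_poly n c)) ` C"

definition constacyclic_code :: "nat \<Rightarrow> 'a::field \<Rightarrow> (nat \<Rightarrow> 'a) set \<Rightarrow> bool" where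
  "constacyclic_code n \<mu> C \<longleftrightarrow>
     \<mu> \<noteq> 0 \<and> linear_code n C \<and> ideal (code_classes n \<mu> C) (constacyclic_ring n \<mu>)"

definition generator_poly :: "nat \<Rightarrow> 'a::field \<Rightarrow> (nat \<Rightarrow> 'a) set \<Rightarrow> 'a poly \<Rightarrow> bool" where
  "generator_poly n \<mu> C g \<longleftrightarrow>
     lead_coeff g = 1 \<and> g dvd (monom 1 n - [:\<mu>:]) \<and>
     code_classes n \<mu> C = cgenideal (constacyclic_ring n \<mu>) (residue_class n \<mu> g)"

definition code_generated_by :: "nat \<Rightarrow> 'a::field \<Rightarrow> 'a poly \<Rightarrow> (nat \<Rightarrow> 'a) set" where
  "code_generated_by n \<mu> g = (THE C. constacyclic_code n \<mu> C \<and> generator_poly n \<mu> C g)"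

definition primitive_element :: "'a::field \<Rightarrow> bool" where
  "primitive_element a \<longleftrightarrow> range (\<lambda>k::nat. a ^ k) = UNIV - {0}"

definition wt :: "nat \<Rightarrow> nat \<Rightarrow> nat \<Rightarrow> nat" where
  "wt q m i = (\<Sum>j<m. (i div q ^ j) mod q)"

definition T_set :: "nat \<Rightarrow> nat \<Rightarrow> nat \<Rightarrow> nat set" where
  "T_set q m l = {i. i < q ^ m - 1 \<and> wt q m i = 1 + (q - 1) * l}"

definition code_length :: "nat \<Rightarrow> nat \<Rightarrow> nat" where
  "code_length q m = (q ^ m - 1) div (q - 1)"

text \<open>The extension of \<open>GF(q)\<close> by \<open>GF(q^m)\<close> is given by a field embedding \<open>emb\<close>. The product of the
  \<open>x - \<beta>^i\<close> has its coefficients in the image of \<open>emb\<close>; the following is its unique preimage.\<close>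

definition T_poly :: "('a::field \<Rightarrow> 'b::field) \<Rightarrow> nat \<Rightarrow> nat \<Rightarrow> nat \<Rightarrow> 'b \<Rightarrow> 'a poly" where
  "T_poly emb q m l \<beta> = (THE g. map_poly emb g = (\<Prod>i\<in>T_set q m l. [:- (\<beta> ^ i), 1:]))"

definition T_code ::
    "('a::field \<Rightarrow> 'b::field) \<Rightarrow> nat \<Rightarrow> nat \<Rightarrow> nat \<Rightarrow> 'a \<Rightarrow> 'b \<Rightarrow> (nat \<Rightarrow> 'a) set" where
  "T_code emb q m l lam \<beta> = code_generated_by (code_length q m) lam (T_poly emb q m l \<beta>)"

text \<open>In \<open>T_count\<close> below, an upper argument is the lower one plus \<open>m - 1\<close>, so that \<open>nat a\<close> never
  truncates where \<open>b \<ge> 0\<close>.\<close>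

definition int_binom :: "int \<Rightarrow> int \<Rightarrow> int" where
  "int_binom a b = (if b < 0 then 0 else int (nat a choose nat b))"

definition T_count :: "nat \<Rightarrow> nat \<Rightarrow> nat \<Rightarrow> int" where
  "T_count q m l = (\<Sum>h=0..m. (-1) ^ h * int_binom (int m) (int h) *
     int_binom ((int q - 1) * int l - int h * int q + int m)
               (1 + (int q - 1) * int l - int h * int q))"

text \<open>Each \<open>div 2\<close> below is exact under the parity condition that accompanies it. The
  differences and exponents are integers, since \<open>M - 4\<close> is negative for \<open>m = 2\<close>.\<close>

definition dist_bound :: "nat \<Rightarrow> nat \<Rightarrow> nat \<Rightarrow> real" where
  "dist_bound q m l = (let Q = real q; M = int m; L = int l in
     if (odd m \<and> 0 \<le> L \<and> L \<le> (M - 3) div 2) \<or>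
        (m mod 4 = 0 \<and> 0 \<le> L \<and> L \<le> (M - 4) div 2) \<or>
        (m mod 4 = 2 \<and> 0 \<le> L \<and> L \<le> (M - 6) div 2)
       then 2 * Q ^ l + 1
     else if m mod 4 = 2 \<and> (M - 4) div 2 \<le> L \<and> L \<le> (M + 2) div 2
       then Q powi ((M - 4) div 2) + 1
     else if m mod 4 = 0 \<and> L \<in> {(M - 2) div 2, M div 2}
       then Q powi ((M - 2) div 2) + 1
     else if odd m \<and> L = (M - 1) div 2
       then Q powi ((M - 1) div 2) + 1
     else (Q - 1) * Q powi (M - 1 - L) + 1)"

definition dual_dist_bound :: "nat \<Rightarrow> nat \<Rightarrow> nat \<Rightarrow> real" where
  "dual_dist_bound q m l =
     real q powi (int m - 1 - int l) + 2 * (real q ^ l - 1) / (real q - 1)"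

end

(* The digit sum of an integer below q^m is unchanged when multiples of q^h - 1 move units from the
   lowest h digits to the next h digits without a carry. The sets T_(q,m,l) therefore contain long
   arithmetic progressions with difference q^h - 1, and if h is coprime to m then the powers of
   beta^(q^h - 1) with exponents below n are distinct, so that the BCH bound applies; h is (m-1)/2,
   (m-2)/2 or (m-4)/2 according to m mod 4. For large l the complements q^m - 1 - i take the place of
   the exponents i. The zeros of the dual code are the inverses of the beta^i with i = 1 mod q - 1
   outside T_(q,m,l); here a run of consecutive such i is found around 0, because 2 q^l - 1 is the
   least integer with digit sum 1 + (q-1) l. The dimensions come from the generating function
   (1 + x + ... + x^(q-1))^m of the digit sums. *)
theory Submission
  imports Defs
begin

section \<open>Field embeddings and the Frobenius map\<close>

text \<open>Coprimality is what the shape of the bound hinges on: two equal powers of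
  \<open>\<beta> ^ (q ^ h - 1)\<close> would give a power of \<open>\<beta>\<close> fixed by the
  \<open>h\<close>-th and the \<open>m\<close>-th iterate of Frobenius, hence an element of GF(q),
  and those are powers of \<open>\<beta> ^ n\<close> only. Two blocks of \<open>h\<close> digits
  must also fit into \<open>m\<close> digits. For \<open>m = 2\<close> modulo 4 the number (m-2)/2
  is even, so (m-4)/2 is the next candidate.

  The number of terms of a progression is the number of units that the lower block can give away. If
  its initial value is \<open>c * q ^ t - 1\<close>, there are \<open>c * q ^ t\<close> terms. For
  \<open>l < h\<close> the whole digit sum goes into that block (\<open>c = 2\<close>,
  \<open>t = l\<close>). For \<open>h \<le> l < m - h\<close> the block is filled with digits
  \<open>q - 1\<close> (\<open>c = 1\<close>, \<open>t = h\<close>), and the rest of the digit sum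
  sits unchanged in the upper \<open>m - 2 * h\<close> digits. For \<open>l \<ge> m - h\<close> the
  complements have digit sum \<open>(q - 1) * (m - l) - 1\<close>, which fits into one block
  (\<open>c = q - 1\<close>, \<open>t = m - 1 - l\<close>). The BCH bound adds 1 to each of these
  numbers.\<close>

lemma field_embedding_iff:
  "field_embedding f \<longleftrightarrow>
     f 1 = 1 \<and> (\<forall>x y. f (x + y) = f x + f y) \<and> (\<forall>x y. f (x * y) = f x * f y)"
  by (auto simp: field_embedding_def ring_hom_def type_ring_def)

lemma
  assumes "field_embedding f"
  shows field_embedding_1: "f 1 = 1"
    and field_embedding_add: "f (x + y) = f x + f y"
    and field_embedding_mult: "f (x * y) = f x * f y"
  using assms by (auto simp: field_embedding_iff)

lemma field_embedding_0: "field_embedding f \<Longrightarrow> f 0 = 0"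
  using field_embedding_add[of f 0 0] by (metis add_0 add_cancel_left_left)

lemma field_embedding_uminus: "field_embedding f \<Longrightarrow> f (- x) = - f x"
  using field_embedding_add[of f x "- x"] by (simp add: field_embedding_0 minus_unique)

lemma field_embedding_diff: "field_embedding f \<Longrightarrow> f (x - y) = f x - f y"
  using field_embedding_add[of f x "- y"] by (simp add: field_embedding_uminus)

lemma field_embedding_power: "field_embedding f \<Longrightarrow> f (x ^ k) = f x ^ k"
  by (induction k) (auto simp: field_embedding_1 field_embedding_mult)

lemma field_embedding_eq_0_iff: "field_embedding f \<Longrightarrow> f x = 0 \<longleftrightarrow> x = 0"
  using field_embedding_mult[of f x "inverse x"]
  by (cases "x = 0") (auto simp: field_embedding_0 field_embedding_1)

lemma field_embedding_inj: "field_embedding f \<Longrightarrow> inj f"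
  by (rule injI) (metis eq_iff_diff_eq_0 field_embedding_diff field_embedding_eq_0_iff)

lemma field_embedding_sum: "field_embedding f \<Longrightarrow> f (sum g A) = (\<Sum>x\<in>A. f (g x))"
  by (induction A rule: infinite_finite_induct) (auto simp: field_embedding_0 field_embedding_add)

lemma coeff_map_poly_embedding: "field_embedding f \<Longrightarrow> coeff (map_poly f p) i = f (coeff p i)"
  by (simp add: coeff_map_poly field_embedding_0)

lemma degree_map_poly_embedding: "field_embedding f \<Longrightarrow> degree (map_poly f p) = degree p"
  by (cases "p = 0") (auto intro!: map_poly_degree_eq simp: field_embedding_eq_0_iff)

lemma map_poly_embedding_eq_0_iff: "field_embedding f \<Longrightarrow> map_poly f p = 0 \<longleftrightarrow> p = 0"
  by (auto simp: poly_eq_iff coeff_map_poly_embedding field_embedding_eq_0_iff)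

lemma map_poly_embedding_inj: "field_embedding f \<Longrightarrow> inj (map_poly f)"
  by (rule injI) (metis poly_eqI coeff_map_poly_embedding field_embedding_inj injD)

lemma map_poly_embedding_add:
  "field_embedding f \<Longrightarrow> map_poly f (p + r) = map_poly f p + map_poly f r"
  by (intro poly_eqI) (simp add: coeff_map_poly_embedding field_embedding_add)

lemma map_poly_embedding_diff:
  "field_embedding f \<Longrightarrow> map_poly f (p - r) = map_poly f p - map_poly f r"
  by (intro poly_eqI) (simp add: coeff_map_poly_embedding field_embedding_diff)

lemma map_poly_embedding_mult:
  "field_embedding f \<Longrightarrow> map_poly f (p * r) = map_poly f p * map_poly f r"
  by (intro poly_eqI)
    (simp add: coeff_map_poly_embedding coeff_mult field_embedding_sum field_embedding_mult)

lemma map_poly_embedding_prod: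
  "field_embedding f \<Longrightarrow> map_poly f (prod g A) = (\<Prod>x\<in>A. map_poly f (g x))"
  by (induction A rule: infinite_finite_induct)
    (auto simp: map_poly_embedding_mult field_embedding_1 map_poly_1')

lemma map_poly_embedding_linear:
  "field_embedding f \<Longrightarrow> map_poly f [:a, b:] = [:f a, f b:]"
  by (simp add: map_poly_pCons field_embedding_0)

lemma map_poly_embedding_monom:
  "field_embedding f \<Longrightarrow> map_poly f (monom a k) = monom (f a) k"
  by (simp add: map_poly_monom field_embedding_0)

text \<open>Division with remainder commutes with the coefficientwise embedding. If the image of
  \<open>p\<close> divides that of \<open>r\<close>, it divides the image of the remainder, whose
  degree is too small unless it is zero.\<close>

lemma map_poly_embedding_dvd_iff:
  assumes f: "field_embedding f"
  shows "map_poly f p dvd map_poly f r \<longleftrightarrow> p dvd r"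
proof
  assume dvd: "map_poly f p dvd map_poly f r"
  have eq: "map_poly f r = map_poly f p * map_poly f (r div p) + map_poly f (r mod p)"
    by (metis div_mult_mod_eq f map_poly_embedding_add map_poly_embedding_mult mult.commute)
  then have "map_poly f p dvd map_poly f (r mod p)"
    using dvd by (metis dvd_add_right_iff dvd_triv_left)
  then have "r mod p = 0 \<or> degree p \<le> degree (r mod p)"
    using dvd_imp_degree_le[of "map_poly f p" "map_poly f (r mod p)"] f
    by (auto simp: degree_map_poly_embedding map_poly_embedding_eq_0_iff)
  moreover have "p = 0 \<Longrightarrow> r = 0"
    using dvd f by (simp add: map_poly_embedding_eq_0_iff)
  ultimately show "p dvd r"
    using degree_mod_less[of p r] by (cases "p = 0") (auto simp: dvd_eq_mod_eq_0)
next
  assume "p dvd r"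
  then show "map_poly f p dvd map_poly f r"
    by (auto simp: map_poly_embedding_mult[OF f] elim!: dvdE)
qed

section \<open>Polynomials with prescribed roots\<close>

lemma prod_linear_factors_dvd:
  fixes p :: "'a::idom poly"
  assumes "finite A" "inj_on f A" "\<And>x. x \<in> A \<Longrightarrow> poly p (f x) = 0"
  shows "(\<Prod>x\<in>A. [:- f x, 1:]) dvd p"
  using assms
proof (induction A arbitrary: p rule: finite_induct)
  case (insert a A)
  then obtain r where r: "p = [:- f a, 1:] * r"
    by (metis dvdE insertI1 poly_eq_0_iff_dvd)
  have "poly r (f x) = 0" if "x \<in> A" for x
  proof -
    have "f x \<noteq> f a"
      using insert.prems(1) insert.hyps(2) that by (auto simp: inj_on_def)
    moreover have "(f x - f a) * poly r (f x) = 0"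
      using insert.prems(2)[of x] that by (simp add: r algebra_simps)
    ultimately show ?thesis
      by simp
  qed
  with insert have "(\<Prod>x\<in>A. [:- f x, 1:]) dvd r"
    by simp
  then show ?case
    unfolding r prod.insert[OF insert.hyps(1,2)] by (rule mult_dvd_mono[OF dvd_refl])
qed simp

lemma degree_prod_linear_factors:
  "finite A \<Longrightarrow> degree (\<Prod>x\<in>A. [:- f x, 1:] :: 'a::idom poly) = card A"
  by (subst degree_prod_eq_sum_degree) auto

lemma lead_coeff_prod_linear_factors:
  "lead_coeff (\<Prod>x\<in>A. [:- f x, 1:] :: 'a::idom poly) = 1"
  by (simp add: lead_coeff_prod)

lemma poly_eq_0_if_many_roots:
  fixes p :: "'a::idom poly"
  assumes "finite A" "\<And>x. x \<in> A \<Longrightarrow> poly p x = 0" "degree p < card A"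
  shows "p = 0"
proof (rule ccontr)
  assume "p \<noteq> 0"
  then have "card A \<le> card {x. poly p x = 0}"
    using assms by (intro card_mono poly_roots_finite) auto
  also have "\<dots> \<le> degree p"
    by (rule card_poly_roots_bound[OF \<open>p \<noteq> 0\<close>])
  finally show False
    using assms by simp
qed

section \<open>The Frobenius map and descent to the subfield with \<open>q\<close> elements\<close>

context
  fixes emb :: "'a::finite_field \<Rightarrow> 'b::field" and q :: nat
  assumes emb: "field_embedding emb" and q: "card (UNIV :: 'a set) = q"
begin

lemma card_field_gt_1: "q > 1"
  using card_mono[of UNIV "{0, 1 :: 'a}"] q by simp

text \<open>As polynomials in \<open>x\<close> both sides are monic of degree \<open>q\<close> and
  vanish on the image of \<open>emb\<close>. Their difference has degree below \<open>q\<close> and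
  \<open>q\<close> roots.\<close>

lemma power_card_diff_eq_prod: "x ^ q - x = (\<Prod>a\<in>UNIV. x - emb a)"
proof -
  let ?p = "monom 1 q - monom 1 1 :: 'b poly" and ?r = "\<Prod>a\<in>(UNIV :: 'a set). [:- emb a, 1:]"
  have q1: "q > 1"
    by (rule card_field_gt_1)
  have r: "degree ?r = q" "coeff ?r q = 1"
    using degree_prod_linear_factors[of "UNIV :: 'a set" emb]
      lead_coeff_prod_linear_factors[of emb "UNIV :: 'a set"] q by auto
  have "?p - ?r = 0"
  proof (rule poly_eq_0_if_many_roots)
    show "finite (range emb)"
      by simp
    show "poly (?p - ?r) y = 0" if "y \<in> range emb" for y
    proof -
      from that obtain a where y: "y = emb a"
        by auto
      have "poly ?r y = 0"
        by (auto simp: poly_prod y)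
      moreover have "y ^ q = y"
        unfolding y using finite_field_power_card_eq_same[of a] q
        by (simp add: field_embedding_power[OF emb, symmetric])
      ultimately show ?thesis
        by (simp add: poly_monom)
    qed
    have "degree (?p - ?r) \<le> q" "coeff (?p - ?r) q = 0"
      using q1 r by (auto intro!: degree_diff_le degree_monom_le order.trans[OF degree_monom_le])
    then have "degree (?p - ?r) < q"
      using q1 by (metis degree_0 eq_zero_or_degree_less not_less_zero order_less_trans zero_less_one)
    then show "degree (?p - ?r) < card (range emb)"
      by (simp add: card_image[OF field_embedding_inj[OF emb]] q)
  qed
  then have "poly ?p x = poly ?r x"
    by simp
  then show ?thesis
    by (simp add: poly_prod poly_monom)
qed

text \<open>The polynomial \<open>(X + y)^q - X^q - y^q\<close> has degree less than \<open>q\<close>, and it vanishes on the subfield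
  with \<open>q\<close> elements because \<open>X^q - X\<close> is invariant under translation by this subfield.\<close>

lemma power_card_add: "(x + y) ^ q = x ^ q + (y :: 'b) ^ q"
proof -
  let ?p = "[:y, 1:] ^ q - monom 1 q - [:y ^ q:]"
  have q1: "q > 1"
    by (rule card_field_gt_1)
  have "?p = 0"
  proof (rule poly_eq_0_if_many_roots)
    show "finite (range emb)"
      by simp
    show "poly ?p z = 0" if "z \<in> range emb" for z
    proof -
      from that obtain c where z: "z = emb c"
        by auto
      have "(y + z) ^ q - (y + z) = (\<Prod>a\<in>UNIV. y + z - emb a)"
        by (rule power_card_diff_eq_prod)
      also have "\<dots> = (\<Prod>a\<in>UNIV. y - emb a)"
        by (rule prod.reindex_bij_witness[of _ "\<lambda>a. a + c" "\<lambda>a. a - c"])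
          (auto simp: z field_embedding_diff[OF emb])
      also have "\<dots> = y ^ q - y"
        by (rule power_card_diff_eq_prod[symmetric])
      finally have "(y + z) ^ q = y ^ q + z"
        by (simp add: algebra_simps)
      moreover have "z ^ q = z"
        unfolding z using finite_field_power_card_eq_same[of c] q
        by (simp add: field_embedding_power[OF emb, symmetric])
      ultimately show ?thesis
        by (simp add: poly_monom)
    qed
    have d: "degree ([:y, 1:] ^ q) = q"
      by (simp add: degree_linear_power)
    have "coeff ([:y, 1:] ^ q) q = 1"
      using lead_coeff_power[of "[:y, 1:]" q] d by simp
    moreover have "coeff [:y ^ q:] q = 0"
      using q1 by (intro coeff_eq_0) simp
    ultimately have "coeff ?p q = 0"
      by simp
    moreover have "degree ?p \<le> q"
      by (intro degree_diff_le) (simp_all add: d degree_monom_le)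
    ultimately have "degree ?p < q"
      using q1 by (metis degree_0 eq_zero_or_degree_less not_less_zero order_less_trans zero_less_one)
    then show "degree ?p < card (range emb)"
      by (simp add: card_image[OF field_embedding_inj[OF emb]] q)
  qed
  then have "poly ?p x = 0"
    by (metis poly_0)
  then show ?thesis
    by (simp add: poly_monom algebra_simps)
qed

lemma field_embedding_frobenius: "field_embedding (\<lambda>x :: 'b. x ^ q)"
  by (simp add: field_embedding_iff power_card_add power_mult_distrib)

lemma in_range_emb_iff: "x \<in> range emb \<longleftrightarrow> x ^ q = x"
proof -
  have "x ^ q = x \<longleftrightarrow> (\<Prod>a\<in>UNIV. x - emb a) = 0"
    by (simp add: power_card_diff_eq_prod[symmetric])
  then show ?thesis
    by auto
qed

text \<open>Frobenius permutes the linear factors, so it fixes every coefficient of the product, and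
  the fixed points of Frobenius are exactly the image of \<open>emb\<close>.\<close>

lemma prod_linear_factors_descent:
  assumes "finite R" "(\<lambda>x. x ^ q) ` R = R"
  obtains g where "map_poly emb g = (\<Prod>x\<in>R. [:- x, 1:])"
proof -
  let ?P = "\<Prod>x\<in>R. [:- x, 1 :: 'b:]"
  have inj: "inj_on (\<lambda>x. x ^ q) R"
    using assms by (simp add: eq_card_imp_inj_on)
  have uminus: "(- x) ^ q = - (x ^ q)" for x :: 'b
    using field_embedding_uminus[OF field_embedding_frobenius] .
  have "map_poly (\<lambda>x. x ^ q) ?P = (\<Prod>x\<in>R. [:- (x ^ q), 1:])"
    using field_embedding_frobenius
    by (simp add: map_poly_embedding_prod map_poly_embedding_linear uminus)
  also have "\<dots> = (\<Prod>x\<in>(\<lambda>x. x ^ q) ` R. [:- x, 1:])"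
    by (simp add: prod.reindex[OF inj])
  finally have "map_poly (\<lambda>x. x ^ q) ?P = ?P"
    using assms by simp
  then have "coeff ?P i ^ q = coeff ?P i" for i
    by (metis coeff_map_poly_embedding field_embedding_frobenius)
  then have "coeff ?P i \<in> range emb" for i
    by (simp add: in_range_emb_iff)
  then have coeff: "emb (inv_into UNIV emb (coeff ?P i)) = coeff ?P i" for i
    by (simp add: f_inv_into_f)
  have inv0: "inv_into UNIV emb 0 = 0"
    using field_embedding_0[OF emb] field_embedding_inj[OF emb] by (metis inv_f_f)
  have "map_poly emb (map_poly (inv_into UNIV emb) ?P) = ?P"
    by (intro poly_eqI) (simp only: coeff_map_poly_embedding[OF emb] coeff_map_poly inv0 coeff)
  then show thesis
    by (rule that)
qed

end

text \<open>Since \<open>b ^ N = 1\<close>, exponents can be reduced modulo \<open>N\<close>. The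
  powers with exponent below \<open>N\<close> therefore exhaust the \<open>N\<close> nonzero
  elements, which leaves no room for a repetition.\<close>

lemma primitive_element_power_card:
  fixes b :: "'a::finite_field"
  assumes "primitive_element b" "N = card (UNIV :: 'a set) - 1"
  shows "b \<noteq> 0" "b ^ N = 1" "inj_on (\<lambda>i. b ^ i) {..<N}" "N > 0"
proof -
  have "b ^ 1 \<in> range (\<lambda>k. b ^ k)"
    by blast
  then show b0: "b \<noteq> 0"
    using assms by (auto simp: primitive_element_def)
  have "card (UNIV - {0 :: 'a}) = N"
    using assms by (simp add: card_Diff_singleton)
  moreover have "(1 :: 'a) \<in> UNIV - {0}"
    by simp
  ultimately show N: "N > 0"
    by (metis card_gt_0_iff empty_iff finite)
  have "b * b ^ N = b ^ card (UNIV :: 'a set)"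
    using assms N power_Suc[of b N] by (simp del: power_Suc)
  then show one: "b ^ N = 1"
    using finite_field_power_card_eq_same[of b] b0 by simp
  have "b ^ k \<in> (\<lambda>i. b ^ i) ` {..<N}" for k
  proof -
    have "b ^ k = (b ^ N) ^ (k div N) * b ^ (k mod N)"
      by (simp flip: power_add power_mult)
    also have "\<dots> = b ^ (k mod N)"
      by (simp add: one)
    finally show ?thesis
      using N by (auto intro!: image_eqI[of _ _ "k mod N"])
  qed
  then have "range (\<lambda>i. b ^ i) = (\<lambda>i. b ^ i) ` {..<N}"
    by blast
  then have "UNIV - {0} = (\<lambda>i. b ^ i) ` {..<N}"
    using assms(1) by (simp add: primitive_element_def)
  then show "inj_on (\<lambda>i. b ^ i) {..<N}"
    using \<open>card (UNIV - {0 :: 'a}) = N\<close> by (intro eq_card_imp_inj_on) auto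
qed

section \<open>Digit sums\<close>

lemma wt_0 [simp]: "wt q 0 i = 0"
  by (simp add: wt_def)

lemma wt_Suc: "wt q (Suc m) i = i mod q + wt q m (i div q)"
  by (simp add: wt_def sum.lessThan_Suc_shift div_mult2_eq del: sum.lessThan_Suc)

lemma wt_Suc_append: "r < q \<Longrightarrow> wt q (Suc m) (q * a + r) = r + wt q m a"
  by (simp add: wt_Suc)

lemma wt_zero [simp]: "wt q m 0 = 0"
  by (simp add: wt_def)

lemma wt_split:
  assumes "a < q ^ h"
  shows "wt q (h + k) (a + q ^ h * b) = wt q h a + wt q k b"
  using assms
proof (induction h arbitrary: a)
  case (Suc h)
  have q: "q > 0"
    using Suc.prems by (cases "q = 0") auto
  have "a div q < q ^ h"
    using Suc.prems by (simp add: div_less_iff_less_mult q mult.commute)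
  moreover have "(a + q ^ Suc h * b) mod q = a mod q" "(a + q ^ Suc h * b) div q = a div q + q ^ h * b"
    using q by (simp_all add: mult.assoc)
  ultimately show ?case
    using Suc.IH[of "a div q"] by (simp add: wt_Suc)
qed simp

text \<open>The number \<open>c * q ^ s - 1\<close> consists of \<open>s\<close> digits
  \<open>q - 1\<close> below a digit \<open>c - 1\<close>. No digit of a smaller number
  \<open>j\<close> exceeds the digit above it in the subtraction, so nothing is borrowed. For
  \<open>s = m\<close> the digit \<open>c - 1\<close> would lie outside the \<open>m\<close> digits
  counted, hence \<open>c = 1\<close> there.\<close>

lemma wt_no_carry:
  assumes "1 \<le> c" "c \<le> q" "j < c * q ^ s" "s < m \<or> c = 1 \<and> s = m"
  shows "wt q m (c * q ^ s - 1 - j) + wt q m j = c - 1 + (q - 1) * s"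
  using assms(3,4)
proof (induction s arbitrary: j m)
  case 0
  show ?case
  proof (cases m)
    case (Suc m')
    then show ?thesis
      using assms(1,2) 0 by (simp add: wt_Suc)
  qed (use 0 in auto)
next
  case (Suc s)
  from Suc.prems obtain m' where m: "m = Suc m'"
    by (cases m) auto
  have q: "q > 0"
    using assms by simp
  define r a where "r = j mod q" and "a = j div q"
  have j: "j = q * a + r" "r < q"
    using q by (auto simp: r_def a_def)
  have a: "a < c * q ^ s"
    using Suc.prems(1) by (simp add: a_def div_less_iff_less_mult q ac_simps)
  then obtain d where d: "c * q ^ s = a + d + 1"
    by (metis Suc_eq_plus1 less_imp_Suc_add add_Suc_right)
  have "c * q ^ Suc s = q * (c * q ^ s)"
    by simp
  also have "\<dots> = q * a + q * d + q"
    unfolding d by (simp add: algebra_simps)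
  finally have "c * q ^ Suc s = q * a + q * d + q" .
  then have "c * q ^ Suc s - 1 - j = q * d + (q - 1 - r)"
    using j by simp
  moreover have "c * q ^ s - 1 - a = d"
    using d by simp
  ultimately have "wt q m (c * q ^ Suc s - 1 - j) = q - 1 - r + wt q m' (c * q ^ s - 1 - a)"
    using q m by (simp add: wt_Suc_append)
  moreover have "wt q m j = r + wt q m' a"
    using j m by (simp add: wt_Suc_append)
  moreover have "wt q m' (c * q ^ s - 1 - a) + wt q m' a = c - 1 + (q - 1) * s"
    using Suc.IH[OF a] Suc.prems(2) m by auto
  moreover have "(q - 1) * Suc s = (q - 1) + (q - 1) * s"
    by simp
  ultimately show ?case
    using j(2) q assms(1) by linarith
qed

lemma wt_complement: "q > 0 \<Longrightarrow> i < q ^ m \<Longrightarrow> wt q m (q ^ m - 1 - i) + wt q m i = (q - 1) * m"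
  using wt_no_carry[of 1 q i m m] by simp

lemma wt_le:
  assumes "1 \<le> c" "c \<le> q" "i < c * q ^ s"
  shows "wt q m i \<le> c - 1 + (q - 1) * s"
  using assms(3)
proof (induction s arbitrary: i m)
  case 0
  then show ?case
    using assms(1,2) by (cases m) (auto simp: wt_Suc)
next
  case (Suc s)
  have q: "q > 0"
    using assms by simp
  have "i div q < c * q ^ s"
    using Suc.prems q by (simp add: div_less_iff_less_mult ac_simps)
  then have IH: "wt q m' (i div q) \<le> c - 1 + (q - 1) * s" for m'
    by (rule Suc.IH)
  have r: "i mod q < q"
    using q by simp
  show ?case
  proof (cases m)
    case (Suc m')
    have "wt q m i = i mod q + wt q m' (i div q)"
      by (simp add: Suc wt_Suc)
    then show ?thesis
      using IH[of m'] r by simp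
  qed simp
qed

text \<open>Together with \<open>wt_no_carry\<close> this makes \<open>c * q ^ s - 1\<close> the
  least integer with its digit sum. It is applied with \<open>c = 2\<close> to exponents and with
  \<open>c = q - 1\<close> to their complements.\<close>

lemma wt_less:
  assumes "1 \<le> c" "c \<le> q" "i + 1 < c * q ^ s"
  shows "wt q m i < c - 1 + (q - 1) * s"
  using assms(3)
proof (induction s arbitrary: i m)
  case 0
  then show ?case
  proof (cases m)
    case (Suc m')
    then show ?thesis
      using assms(1,2) 0 by (simp add: wt_Suc)
  qed (use 0 in simp)
next
  case (Suc s)
  have q: "q > 0"
    using assms by simp
  show ?case
  proof (cases m)
    case 0
    have "c * q ^ Suc s > 1"
      using Suc.prems by simp
    then have "q > 1 \<or> c > 1"
      using assms q by (cases "q = 1") auto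
    then show ?thesis
      using 0 assms(1,2) by auto
  next
    case (Suc m')
    define r a where "r = i mod q" and "a = i div q"
    have i: "i = q * a + r" "r < q"
      using q by (auto simp: r_def a_def)
    have wt: "wt q m i = r + wt q m' a"
      using i Suc by (simp add: wt_Suc_append)
    have step: "c * q ^ Suc s = q * (c * q ^ s)"
      by simp
    then have "q * a < q * (c * q ^ s)"
      using Suc.prems i by linarith
    then have le: "a + 1 \<le> c * q ^ s"
      using q by simp
    \<comment> \<open>Either the number without its last digit is already below the extremal value
      \<open>c * q ^ s - 1\<close>, or it equals this value and the last digit is less than
      \<open>q - 1\<close>.\<close>
    show ?thesis
    proof (cases "a + 1 < c * q ^ s")
      case True
      then have "wt q m' a < c - 1 + (q - 1) * s"
        by (rule Suc.IH)
      then show ?thesis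
        using wt i(2) by simp
    next
      case False
      then have a: "a = c * q ^ s - 1" and "c * q ^ s = a + 1"
        using le by auto
      then have "c * q ^ Suc s = q * a + q"
        by (simp only: step distrib_left mult_1_right)
      then have r: "r + 1 < q"
        using Suc.prems i by simp
      have "wt q m' a \<le> c - 1 + (q - 1) * s"
        using assms(1,2) \<open>c * q ^ s = a + 1\<close> by (intro wt_le) auto
      then show ?thesis
        using wt r by simp
    qed
  qed
qed

text \<open>Multiplication by \<open>q\<close> modulo \<open>q ^ m - 1\<close> is a cyclic shift of the digits.\<close>

lemma wt_shift:
  assumes "i < q ^ Suc k"
  shows "wt q (Suc k) (q * (i mod q ^ k) + i div q ^ k) = wt q (Suc k) i"
proof -
  have q: "q > 0"
    using assms by (cases "q = 0") auto
  have d: "i div q ^ k < q"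
    using assms q by (simp add: div_less_iff_less_mult)
  have "wt q (Suc k) i = wt q (k + 1) (i mod q ^ k + q ^ k * (i div q ^ k))"
    by simp
  also have "\<dots> = wt q k (i mod q ^ k) + i div q ^ k"
    using q d by (subst wt_split) (auto simp: wt_Suc)
  finally show ?thesis
    using d by (simp add: wt_Suc_append)
qed

section \<open>The number of integers with a given digit sum\<close>

lemma sum_split_digit:
  fixes f :: "nat \<Rightarrow> 'a::comm_monoid_add"
  shows "(\<Sum>i<n * q. f i) = (\<Sum>a<n. \<Sum>r<q. f (q * a + r))"
proof -
  have "sum f {a * q..<a * q + q} = (\<Sum>r<q. f (q * a + r))" for a
    by (rule sum.reindex_bij_witness[of _ "\<lambda>r. q * a + r" "\<lambda>i. i - q * a"])
      (auto simp: algebra_simps)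
  then show ?thesis
    by (simp add: sum.nat_group[symmetric])
qed

lemma wt_generating_function:
  "(\<Sum>i<q ^ m. x ^ wt q m i) = (\<Sum>k<q. x ^ k :: 'a::comm_semiring_1) ^ m"
proof (induction m)
  case (Suc m)
  have "(\<Sum>i<q ^ Suc m. x ^ wt q (Suc m) i) = (\<Sum>a<q ^ m. \<Sum>r<q. x ^ wt q (Suc m) (q * a + r))"
    using sum_split_digit[of "\<lambda>i. x ^ wt q (Suc m) i" "q ^ m" q] by (simp add: mult.commute)
  also have "\<dots> = (\<Sum>a<q ^ m. \<Sum>r<q. x ^ wt q m a * x ^ r)"
    by (intro sum.cong refl) (auto simp: wt_Suc_append power_add intro: mult.commute)
  also have "\<dots> = (\<Sum>a<q ^ m. x ^ wt q m a) * (\<Sum>r<q. x ^ r)"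
    by (simp add: sum_product)
  finally show ?case
    by (simp add: Suc.IH mult.commute)
qed simp

text \<open>Multiplying the generating function by \<open>(1 - X) ^ m\<close> gives
  \<open>(1 - X ^ q) ^ m\<close>. The formula is the coefficient of \<open>X ^ s\<close> in the
  binomial expansion of the latter times the series of \<open>1 / (1 - X) ^ m\<close>. Rational
  coefficients make this inverse available.\<close>

lemma card_wt_eq:
  assumes "m > 0"
  shows "int (card {i. i < q ^ m \<and> wt q m i = s}) =
    (\<Sum>h=0..m. (-1) ^ h * int (m choose h) *
       (if h * q \<le> s then int ((m + (s - h * q) - 1) choose (s - h * q)) else 0))"
proof -
  define X where "X = (fps_X :: rat fps)"
  let ?G = "\<Sum>i<q ^ m. X ^ wt q m i"
  let ?B = "Abs_fps (\<lambda>k. of_nat ((m + k - 1) choose k)) :: rat fps"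
  have inv: "inverse ((1 - X) ^ m) = ?B"
    using one_minus_const_fps_X_neg_power'[of m "1 :: rat"] assms by (simp add: X_def)
  have eq: "(1 - X) ^ m * ?G = (1 - X ^ q) ^ m"
    by (simp only: wt_generating_function one_diff_power_eq[of X q] power_mult_distrib)
  have "?G * ((1 - X) ^ m * inverse ((1 - X) ^ m)) = ((1 - X) ^ m * ?G) * inverse ((1 - X) ^ m)"
    by (simp only: ac_simps)
  also have "\<dots> = (1 - X ^ q) ^ m * ?B"
    by (simp only: eq inv)
  finally have "?G * ((1 - X) ^ m * inverse ((1 - X) ^ m)) = (1 - X ^ q) ^ m * ?B" .
  moreover have "(1 - X) ^ m * inverse ((1 - X) ^ m) = 1"
    by (rule inverse_mult_eq_1') (simp add: X_def fps_power_zeroth)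
  ultimately have G: "?G = (1 - X ^ q) ^ m * ?B"
    by simp
  have "(1 - X ^ q) ^ m = (\<Sum>h\<le>m. of_nat (m choose h) * (- (X ^ q)) ^ h)"
    using binomial_ring[of "- (X ^ q)" 1 m] by simp
  also have "\<dots> = (\<Sum>h=0..m. fps_const ((-1) ^ h * of_nat (m choose h)) * X ^ (h * q))"
    by (intro sum.cong)
      (auto simp: power_minus[of "X ^ q"] fps_of_nat mult_ac power_mult[symmetric]
        simp flip: fps_const_mult fps_const_power)
  finally have "fps_nth ?G s =
      (\<Sum>h=0..m. fps_nth (fps_const ((-1) ^ h * of_nat (m choose h)) * (X ^ (h * q) * ?B)) s)"
    unfolding G by (simp only: sum_distrib_right fps_sum_nth mult.assoc)
  also have "\<dots> = (\<Sum>h=0..m. (-1) ^ h * of_nat (m choose h) *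
       (if h * q \<le> s then of_nat ((m + (s - h * q) - 1) choose (s - h * q)) else 0))"
    by (intro sum.cong refl) (simp add: X_def fps_X_power_mult_nth)
  also have "fps_nth ?G s = (\<Sum>i<q ^ m. if wt q m i = s then 1 else 0)"
    by (auto simp: fps_sum_nth X_def intro!: sum.cong)
  also have "\<dots> = of_nat (card {i. i < q ^ m \<and> wt q m i = s})"
    by (simp add: sum.If_cases Int_def)
  finally have "(of_int (int (card {i. i < q ^ m \<and> wt q m i = s})) :: rat) = of_int
    (\<Sum>h=0..m. (-1) ^ h * int (m choose h) *
       (if h * q \<le> s then int ((m + (s - h * q) - 1) choose (s - h * q)) else 0))"
    by (simp add: if_distrib of_int_sum cong: if_cong)
  then show ?thesis
    by (simp only: of_int_eq_iff)
qed

text \<open>Only \<open>q ^ m - 1\<close> is at stake. Its digit sum is divisible by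
  \<open>q - 1\<close>, whereas \<open>1 + (q - 1) * l\<close> is not, as \<open>q - 1 > 1\<close>.
  All strings of \<open>m\<close> digits can thus be treated alike.\<close>

lemma T_set_conv:
  assumes "q > 2"
  shows "T_set q m l = {i. i < q ^ m \<and> wt q m i = 1 + (q - 1) * l}"
proof -
  have "wt q m (q ^ m - 1) \<noteq> 1 + (q - 1) * l"
  proof
    have "wt q m (q ^ m - 1) = (q - 1) * m"
      using wt_complement[of q 0 m] assms by simp
    also assume "wt q m (q ^ m - 1) = 1 + (q - 1) * l"
    finally have "q - 1 dvd 1 + (q - 1) * l"
      by (metis dvd_triv_left)
    then have "q - 1 dvd 1"
        by (metis dvd_add_left_iff dvd_triv_left)
    then show False
      using assms by simp
  qed
  moreover have "i < q ^ m \<Longrightarrow> i \<noteq> q ^ m - 1 \<Longrightarrow> i < q ^ m - 1" for i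
    by simp
  ultimately show ?thesis
    by (fastforce simp: T_set_def)
qed

lemma finite_T_set [simp]: "finite (T_set q m l)"
  by (simp add: T_set_def)

lemma card_T_set:
  assumes "q > 2" "m > 0"
  shows "int (card (T_set q m l)) = T_count q m l"
proof -
  let ?s = "1 + (q - 1) * l"
  have "int_binom (int m) (int h) *
      int_binom ((int q - 1) * int l - int h * int q + int m) (1 + (int q - 1) * int l - int h * int q)
    = int (m choose h) * (if h * q \<le> ?s then int ((m + (?s - h * q) - 1) choose (?s - h * q)) else 0)"
    for h
  proof -
    have s: "1 + (int q - 1) * int l - int h * int q = int ?s - int (h * q)"
      using assms by (simp add: of_nat_diff)
    have t: "(int q - 1) * int l - int h * int q + int m = int ?s - int (h * q) + int m - 1"
      using s by simp
    show ?thesis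
    proof (cases "h * q \<le> ?s")
      case True
      then obtain d where d: "?s = h * q + d"
        using le_Suc_ex by blast
      have "nat (int d + int m - 1) = m + d - 1"
        using assms by linarith
      then show ?thesis
        unfolding s t int_binom_def d by simp
    next
      case False
      then have "int ?s - int (h * q) < 0"
        by linarith
      then show ?thesis
        unfolding s t int_binom_def using False by simp
    qed
  qed
  then show ?thesis
    unfolding T_set_conv[OF assms(1)] card_wt_eq[OF assms(2)] T_count_def
    by (simp add: mult.assoc)
qed

section \<open>Words and linear codes\<close>

lemma finite_words [simp]: "finite (words n :: (nat \<Rightarrow> 'a::{zero,finite}) set)"
  and card_words: "card (words n :: (nat \<Rightarrow> 'a) set) = card (UNIV :: 'a set) ^ n"
proof -
  have "bij_betw (\<lambda>c. restrict c {..<n}) (words n) ({..<n} \<rightarrow>\<^sub>E (UNIV :: 'a set))"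
    by (rule bij_betwI[where g = "\<lambda>f j. if j < n then f j else 0"])
      (auto simp: words_def fun_eq_iff PiE_def extensional_def)
  then show "finite (words n :: (nat \<Rightarrow> 'a) set)"
    "card (words n :: (nat \<Rightarrow> 'a) set) = card (UNIV :: 'a set) ^ n"
    by (auto simp: bij_betw_finite bij_betw_same_card card_PiE finite_PiE)
qed

lemma linear_code_iff:
  "linear_code n C \<longleftrightarrow> C \<subseteq> words n \<and> (\<lambda>_. 0) \<in> C \<and>
     (\<forall>c\<in>C. \<forall>d\<in>C. (\<lambda>j. c j + d j) \<in> C) \<and> (\<forall>a. \<forall>c\<in>C. (\<lambda>j. a * c j) \<in> C)"
proof -
  interpret vector_space "word_scale :: 'a \<Rightarrow> (nat \<Rightarrow> 'a) \<Rightarrow> nat \<Rightarrow> 'a"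
    by (rule vector_space_word_scale)
  show ?thesis
    by (simp add: linear_code_def subspace_def word_scale_def plus_fun_def zero_fun_def)
qed

lemma
  assumes "linear_code n C"
  shows linear_code_subset: "C \<subseteq> words n"
    and linear_code_zero: "(\<lambda>_. 0) \<in> C"
    and linear_code_add: "c \<in> C \<Longrightarrow> d \<in> C \<Longrightarrow> (\<lambda>j. c j + d j) \<in> C"
    and linear_code_scale: "c \<in> C \<Longrightarrow> (\<lambda>j. a * c j) \<in> C"
  using assms by (auto simp: linear_code_iff)

lemma (in vector_space) card_subspace:
  assumes "subspace V" "finite V" "finite (UNIV :: 'a set)"
  shows "card V = card (UNIV :: 'a set) ^ dim V"
proof -
  obtain B where B: "B \<subseteq> V" "independent B" "V \<subseteq> span B" "card B = dim V"
    by (rule basis_exists)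
  have fin: "finite B"
    using B(1) assms(2) by (rule finite_subset)
  have span: "span B = V"
    using B assms(1) by (simp add: span_minimal subset_antisym)
  have "bij_betw (\<lambda>f. \<Sum>b\<in>B. f b *s b) (B \<rightarrow>\<^sub>E UNIV) V"
    unfolding bij_betw_def
  proof (intro conjI inj_onI)
    fix f g
    assume f: "f \<in> B \<rightarrow>\<^sub>E UNIV" and g: "g \<in> B \<rightarrow>\<^sub>E UNIV"
      and "(\<Sum>b\<in>B. f b *s b) = (\<Sum>b\<in>B. g b *s b)"
    then have "(\<Sum>b\<in>B. (f b - g b) *s b) = 0"
      by (simp add: scale_left_diff_distrib sum_subtractf)
    then have "f b - g b = 0" if "b \<in> B" for b
      using independentD[OF B(2) fin subset_refl _ that, of "\<lambda>b. f b - g b"] by simp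
    then show "f = g"
      using f g by (intro PiE_ext) auto
  next
    have "(\<lambda>f. \<Sum>b\<in>B. f b *s b) ` (B \<rightarrow>\<^sub>E UNIV) = range (\<lambda>f. \<Sum>b\<in>B. f b *s b)"
    proof safe
      fix f :: "'b \<Rightarrow> 'a"
      show "(\<Sum>b\<in>B. f b *s b) \<in> (\<lambda>f. \<Sum>b\<in>B. f b *s b) ` (B \<rightarrow>\<^sub>E UNIV)"
        by (intro image_eqI[of _ _ "restrict f B"]) auto
    qed auto
    then show "(\<lambda>f. \<Sum>b\<in>B. f b *s b) ` (B \<rightarrow>\<^sub>E UNIV) = V"
      using span span_finite[OF fin] by simp
  qed
  then have "card V = card (B \<rightarrow>\<^sub>E (UNIV :: 'a set))"
    by (simp add: bij_betw_same_card)
  then show ?thesis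
    using fin B(4) by (simp add: card_PiE)
qed

text \<open>Over a finite field the dimension is determined by the number of words, so the
  dimensions of the code and of its dual reduce to counting.\<close>

lemma code_dim_eqI:
  fixes C :: "(nat \<Rightarrow> 'a::finite_field) set"
  assumes "linear_code n C" "card C = card (UNIV :: 'a set) ^ d"
  shows "code_dim C = d"
proof -
  interpret vector_space "word_scale :: 'a \<Rightarrow> (nat \<Rightarrow> 'a) \<Rightarrow> nat \<Rightarrow> 'a"
    by (rule vector_space_word_scale)
  have C: "subspace C" "C \<subseteq> words n"
    using assms(1) by (auto simp: linear_code_def)
  have "card {0, 1 :: 'a} \<le> card (UNIV :: 'a set)"
    by (intro card_mono) auto
  then have gt: "card (UNIV :: 'a set) > 1"
    by simp
  have "card (UNIV :: 'a set) ^ dim C = card (UNIV :: 'a set) ^ d"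
    using card_subspace[OF C(1) finite_subset[OF C(2)]] assms(2) by simp
  then show ?thesis
    using power_inject_exp[OF gt] by (simp add: code_dim_def)
qed

text \<open>By linearity distances are weights of differences. A nonzero word has to be exhibited,
  because otherwise the infimum would range over the empty set.\<close>

lemma min_distance_ge:
  fixes C :: "(nat \<Rightarrow> 'a::field) set"
  assumes "linear_code n C" and nontrivial: "\<exists>c\<in>C. c \<noteq> (\<lambda>_. 0)"
    and weight: "\<And>c. c \<in> C \<Longrightarrow> c \<noteq> (\<lambda>_. 0) \<Longrightarrow> d \<le> card {j. j < n \<and> c j \<noteq> 0}"
  shows "d \<le> min_distance n C"
proof -
  let ?S = "{hamming_dist n u v | u v. u \<in> C \<and> v \<in> C \<and> u \<noteq> v}"
  have "(\<lambda>_. 0) \<in> C"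
    using assms(1) by (simp add: linear_code_iff)
  then have ne: "?S \<noteq> {}"
    using nontrivial by blast
  have "Inf ?S \<in> ?S"
    using ne by (rule Inf_nat_def1)
  then obtain u v where uv: "Inf ?S = hamming_dist n u v" "u \<in> C" "v \<in> C" "u \<noteq> v"
    by blast
  have "(\<lambda>j. u j + (- 1 * v j)) \<in> C"
    using assms(1) uv(2,3) by (intro linear_code_add linear_code_scale)
  moreover have "(\<lambda>j. u j + (- 1 * v j)) \<noteq> (\<lambda>_. 0)"
    using uv(4) by (auto simp: fun_eq_iff)
  ultimately have "d \<le> card {j. j < n \<and> u j + (- 1 * v j) \<noteq> 0}"
    by (rule weight)
  then show ?thesis
    by (simp add: min_distance_def uv(1)) (simp add: hamming_dist_def)
qed

text \<open>The BCH bound, for a subfield code whose zeros are \<open>x * y ^ s\<close> with \<open>s < d\<close>.\<close>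

lemma bch_bound:
  fixes emb :: "'a::field \<Rightarrow> 'b::field"
  assumes emb: "field_embedding emb"
    and zeros: "\<And>s. s < d \<Longrightarrow> (\<Sum>j<n. emb (c j) * (x * y ^ s) ^ j) = 0"
    and "x \<noteq> 0" and inj: "inj_on (\<lambda>j. y ^ j) {..<n}"
    and c: "c \<in> words n" "c \<noteq> (\<lambda>_. 0)"
  shows "d + 1 \<le> card {j. j < n \<and> c j \<noteq> 0}"
proof (rule ccontr)
  let ?S = "{j. j < n \<and> c j \<noteq> 0}"
  assume "\<not> ?thesis"
  then have card: "card ?S \<le> d"
    by simp
  obtain k where k: "c k \<noteq> 0"
    using c by auto
  then have "k \<in> ?S"
    using c by (force simp: words_def)
  \<comment> \<open>\<open>P\<close> vanishes at the locators \<open>y ^ j\<close> of all support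
    positions except \<open>k\<close>, and its degree is below \<open>d\<close>. Combining the zeros
    with the coefficients of \<open>P\<close> therefore isolates the term of position
    \<open>k\<close>; this replaces a Vandermonde determinant.\<close>
  define P where "P = (\<Prod>j\<in>?S - {k}. [:- (y ^ j), 1:])"
  have "degree P = card (?S - {k})"
    unfolding P_def by (rule degree_prod_linear_factors) simp
  also have "\<dots> < card ?S"
    using \<open>k \<in> ?S\<close> by (intro card_Diff1_less) auto
  finally have deg: "degree P < d"
    using card by simp
  have "(\<Sum>j<n. emb (c j) * x ^ j * poly P (y ^ j)) =
      (\<Sum>s\<le>degree P. coeff P s * (\<Sum>j<n. emb (c j) * (x * y ^ s) ^ j))"
    by (subst sum_distrib_left, subst sum.swap)
      (simp add: poly_altdef sum_distrib_left power_mult_distrib mult_ac flip: power_mult)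
  also have "\<dots> = 0"
    using zeros deg by (intro sum.neutral) auto
  also have "(\<Sum>j<n. emb (c j) * x ^ j * poly P (y ^ j)) =
      (\<Sum>j\<in>{k}. emb (c j) * x ^ j * poly P (y ^ j))"
  proof (rule sum.mono_neutral_right)
    show "\<forall>j\<in>{..<n} - {k}. emb (c j) * x ^ j * poly P (y ^ j) = 0"
    proof
      fix j assume j: "j \<in> {..<n} - {k}"
      show "emb (c j) * x ^ j * poly P (y ^ j) = 0"
      proof (cases "c j = 0")
        case False
        then have "poly P (y ^ j) = 0"
          using j by (auto simp: P_def poly_prod intro!: prod_zero bexI[of _ j])
        then show ?thesis
          by simp
      qed (simp add: field_embedding_0[OF emb])
    qed
  qed (use \<open>k \<in> ?S\<close> in auto)
  finally have "poly P (y ^ k) = 0"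
    using k \<open>x \<noteq> 0\<close> by (simp add: field_embedding_eq_0_iff[OF emb])
  then obtain j where "j \<in> ?S - {k}" "y ^ k = y ^ j"
    by (auto simp: P_def poly_prod)
  then show False
    using inj \<open>k \<in> ?S\<close> by (auto simp: inj_on_def)
qed

section \<open>Constacyclic codes\<close>

lemma cring_type_ring: "cring (type_ring :: 'a::comm_ring_1 ring)"
proof (rule cringI)
  show "abelian_group (type_ring :: 'a ring)"
    by (rule abelian_groupI) (auto simp: type_ring_def intro: exI[of _ "- x" for x])
  show "comm_monoid (type_ring :: 'a ring)"
    by (rule comm_monoidI) (auto simp: type_ring_def mult_ac)
qed (auto simp: type_ring_def algebra_simps)

lemma type_ring_simps [simp]:
  "carrier type_ring = UNIV" "mult type_ring = (*)" "one type_ring = 1"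
  "zero type_ring = 0" "add type_ring = (+)"
  by (simp_all add: type_ring_def)

lemma modulus_ideal_eq: "modulus_ideal n \<mu> = {p. (monom 1 n - [:\<mu>:]) dvd p}"
  by (auto simp: modulus_ideal_def cgenideal_def dvd_def mult.commute)

lemma ideal_modulus_ideal: "ideal (modulus_ideal n \<mu>) type_ring"
  unfolding modulus_ideal_def by (rule cring.cgenideal_ideal[OF cring_type_ring]) simp

lemma mem_residue_class: "r \<in> residue_class n \<mu> p \<longleftrightarrow> (monom 1 n - [:\<mu>:]) dvd r - p"
proof -
  have "r \<in> residue_class n \<mu> p \<longleftrightarrow> (\<exists>h. (monom 1 n - [:\<mu>:]) dvd h \<and> r = h + p)"
    by (auto simp: residue_class_def a_r_coset_def' modulus_ideal_eq)
  also have "\<dots> \<longleftrightarrow> (monom 1 n - [:\<mu>:]) dvd r - p"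
    by (metis add_diff_cancel_right' diff_add_cancel)
  finally show ?thesis .
qed

lemma residue_class_eq_iff:
  "residue_class n \<mu> p = residue_class n \<mu> r \<longleftrightarrow> (monom 1 n - [:\<mu>:]) dvd p - r"
proof
  assume "residue_class n \<mu> p = residue_class n \<mu> r"
  then have "p \<in> residue_class n \<mu> r"
    by (metis mem_residue_class diff_self dvd_0_right)
  then show "(monom 1 n - [:\<mu>:]) dvd p - r"
    by (simp add: mem_residue_class)
next
  assume dvd: "(monom 1 n - [:\<mu>:]) dvd p - r"
  have "(monom 1 n - [:\<mu>:]) dvd x - p \<longleftrightarrow> (monom 1 n - [:\<mu>:]) dvd x - r" for x
    using dvd_add_left_iff[OF dvd, of "x - p"] by simp
  then show "residue_class n \<mu> p = residue_class n \<mu> r"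
    by (auto simp: mem_residue_class)
qed

lemma carrier_constacyclic_ring: "carrier (constacyclic_ring n \<mu>) = range (residue_class n \<mu>)"
  by (auto simp: constacyclic_ring_def FactRing_def A_RCOSETS_def' residue_class_def)

lemma mult_constacyclic_ring:
  "residue_class n \<mu> p \<otimes>\<^bsub>constacyclic_ring n \<mu>\<^esub> residue_class n \<mu> r = residue_class n \<mu> (p * r)"
  using ideal.rcoset_mult_add[OF ideal_modulus_ideal, of p r n \<mu>]
  by (simp add: constacyclic_ring_def FactRing_def residue_class_def)

lemma cgenideal_constacyclic_ring:
  "cgenideal (constacyclic_ring n \<mu>) (residue_class n \<mu> g) = range (\<lambda>u. residue_class n \<mu> (u * g))"
  by (force simp: cgenideal_def carrier_constacyclic_ring mult_constacyclic_ring[symmetric])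

lemma ideal_residue_classes:
  assumes "0 \<in> J" "\<And>p r. p \<in> J \<Longrightarrow> r \<in> J \<Longrightarrow> p + r \<in> J" "\<And>p r. p \<in> J \<Longrightarrow> r * p \<in> J"
  shows "ideal (residue_class n \<mu> ` J) (constacyclic_ring n \<mu>)"
proof -
  interpret cring "type_ring :: 'a poly ring"
    by (rule cring_type_ring)
  have uminus: "- p \<in> J" if "p \<in> J" for p
    using assms(3)[OF that, of "- 1"] by simp
  have "ideal J type_ring"
  proof (rule idealI[OF ring_axioms])
    show "subgroup J (add_monoid type_ring)"
    proof (rule add.subgroupI)
      show "\<ominus>\<^bsub>type_ring\<^esub> a \<in> J" if "a \<in> J" for a
      proof -
        have "\<ominus>\<^bsub>type_ring\<^esub> a = - a"
          by (rule minus_equality) auto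
        then show ?thesis
          using uminus that by simp
      qed
    qed (use assms in auto)
  qed (use assms in \<open>auto simp: mult.commute\<close>)
  then show ?thesis
    using ring_ideal_imp_quot_ideal[OF ideal_modulus_ideal[of n \<mu>]]
    by (simp add: constacyclic_ring_def residue_class_def[abs_def])
qed

section \<open>Words as representatives of residue classes\<close>

lemma coeff_word_poly: "coeff (word_poly n c) j = (if j < n then c j else 0)"
  by (simp add: word_poly_def coeff_sum coeff_monom)

lemma coeff_word_poly_words: "c \<in> words n \<Longrightarrow> coeff (word_poly n c) = c"
  by (auto simp: coeff_word_poly words_def fun_eq_iff)

lemma coeff_in_words: "p = 0 \<or> degree p < n \<Longrightarrow> coeff p \<in> words n"
  by (auto simp: words_def coeff_eq_0)

lemma word_poly_coeff: "p = 0 \<or> degree p < n \<Longrightarrow> word_poly n (coeff p) = p"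
  by (intro poly_eqI) (auto simp: coeff_word_poly coeff_eq_0)

lemma word_poly_add: "word_poly n (\<lambda>j. c j + d j) = word_poly n c + word_poly n d"
  by (intro poly_eqI) (simp add: coeff_word_poly)

lemma word_poly_scale: "word_poly n (\<lambda>j. a * c j) = smult a (word_poly n c)"
  by (intro poly_eqI) (simp add: coeff_word_poly)

lemma word_poly_zero [simp]: "word_poly n (\<lambda>_. 0) = 0"
  by (intro poly_eqI) (simp add: coeff_word_poly)

lemma word_poly_0 [simp]: "word_poly 0 c = 0"
  by (simp add: word_poly_def)

lemma degree_word_poly: "n > 0 \<Longrightarrow> degree (word_poly n c) < n"
  by (intro degree_lessI) (auto simp: coeff_word_poly)

lemma degree_modulus: "n > 0 \<Longrightarrow> degree (monom 1 n - [:\<mu>:] :: 'a::field poly) = n"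
proof -
  assume "n > 0"
  then have "degree (monom 1 n + [:- \<mu>:]) = degree (monom (1 :: 'a) n)"
    by (intro degree_add_eq_left) (simp add: degree_monom_eq)
  moreover have "monom 1 n - [:\<mu>:] = monom 1 n + [:- \<mu>:]"
    by simp
  ultimately show ?thesis
    by (simp only: degree_monom_eq[OF one_neq_zero])
qed

lemma residue_class_word_poly_inj:
  assumes "n > 0" "c \<in> words n" "d \<in> words n"
    and "residue_class n \<mu> (word_poly n c) = residue_class n \<mu> (word_poly n d)"
  shows "c = d"
proof -
  have "(monom 1 n - [:\<mu>:]) dvd word_poly n c - word_poly n d"
    using assms(4) by (simp add: residue_class_eq_iff)
  moreover have "degree (word_poly n c - word_poly n d) < n"
    using assms(1) by (intro degree_diff_less degree_word_poly)
  ultimately have "word_poly n c - word_poly n d = 0"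
    using dvd_imp_degree_le[of "monom 1 n - [:\<mu>:]" "word_poly n c - word_poly n d"]
      degree_modulus[OF assms(1), of \<mu>] by linarith
  then show ?thesis
    using assms(2,3) by (metis coeff_word_poly_words eq_iff_diff_eq_0)
qed

text \<open>Every residue class contains at most one polynomial of degree below \<open>n\<close>.
  This supplies the uniqueness needed for the definite description in
  \<open>code_generated_by\<close>.\<close>

lemma code_classes_inj:
  assumes "n > 0" "C \<subseteq> words n" "D \<subseteq> words n" "code_classes n \<mu> C = code_classes n \<mu> D"
  shows "C = D"
proof -
  have "inj_on (\<lambda>c. residue_class n \<mu> (word_poly n c)) (words n)"
    by (rule inj_onI) (rule residue_class_word_poly_inj[OF assms(1)])
  then show ?thesis
    using assms(2-4) by (simp add: code_classes_def inj_on_image_eq_iff)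
qed

definition constacyclic_shift :: "nat \<Rightarrow> 'a::field \<Rightarrow> (nat \<Rightarrow> 'a) \<Rightarrow> nat \<Rightarrow> 'a" where
  "constacyclic_shift n \<mu> c j = (if j = 0 then \<mu> * c (n - 1) else if j < n then c (j - 1) else 0)"

text \<open>The shift is multiplication by \<open>x\<close> followed by reduction: the one
  coefficient that reaches degree \<open>n\<close> is removed by a multiple of
  \<open>x^n - \<mu>\<close>.\<close>

lemma word_poly_constacyclic_shift:
  assumes "n > 0"
  shows "word_poly n (constacyclic_shift n \<mu> c) =
    pCons 0 (word_poly n c) - smult (c (n - 1)) (monom 1 n - [:\<mu>:])"
proof (rule poly_eqI)
  fix j
  obtain k where "n = Suc k"
    using assms by (cases n) auto
  then show "coeff (word_poly n (constacyclic_shift n \<mu> c)) j =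
    coeff (pCons 0 (word_poly n c) - smult (c (n - 1)) (monom 1 n - [:\<mu>:])) j"
    by (cases j) (auto simp: coeff_word_poly constacyclic_shift_def coeff_monom coeff_pCons
        less_Suc_eq split: nat.splits)
qed

text \<open>Constants and \<open>x\<close> generate the polynomial ring, so closure under scaling
  and under one shift already gives closure under all multiples. The set \<open>J\<close> of
  polynomials congruent to a codeword is the ideal whose classes are those of the code.\<close>

lemma constacyclic_codeI:
  assumes "n > 0" "\<mu> \<noteq> 0" "linear_code n C"
    and shift: "\<And>c. c \<in> C \<Longrightarrow> constacyclic_shift n \<mu> c \<in> C"
  shows "constacyclic_code n \<mu> C"
proof -
  let ?M = "monom 1 n - [:\<mu>:]"
  define J where "J = {p. \<exists>c\<in>C. ?M dvd p - word_poly n c}"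
  note lin = linear_code_zero[OF assms(3)] linear_code_add[OF assms(3)]
    linear_code_scale[OF assms(3)]
  have add: "p + r \<in> J" if pr: "p \<in> J" "r \<in> J" for p r
  proof -
    obtain c d where c: "c \<in> C" "?M dvd p - word_poly n c" and d: "d \<in> C" "?M dvd r - word_poly n d"
      using pr by (auto simp: J_def)
    have "p + r - word_poly n (\<lambda>j. c j + d j) = (p - word_poly n c) + (r - word_poly n d)"
      by (simp add: word_poly_add)
    then have "?M dvd p + r - word_poly n (\<lambda>j. c j + d j)"
      using c(2) d(2) by (simp only: dvd_add)
    then show ?thesis
      using lin(2)[OF c(1) d(1)] by (auto simp: J_def)
  qed
  have smult: "smult a p \<in> J" if p: "p \<in> J" for a p
  proof -
    obtain c where c: "c \<in> C" "?M dvd p - word_poly n c"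
      using p by (auto simp: J_def)
    have "smult a p - word_poly n (\<lambda>j. a * c j) = smult a (p - word_poly n c)"
      by (simp add: word_poly_scale smult_diff_right)
    then have "?M dvd smult a p - word_poly n (\<lambda>j. a * c j)"
      using c(2) by (simp add: dvd_smult)
    then show ?thesis
      using lin(3)[OF c(1)] by (auto simp: J_def)
  qed
  have shift_mem: "pCons 0 p \<in> J" if p: "p \<in> J" for p
  proof -
    obtain c where c: "c \<in> C" "?M dvd p - word_poly n c"
      using p by (auto simp: J_def)
    have "pCons 0 p - word_poly n (constacyclic_shift n \<mu> c) =
        [:0, 1:] * (p - word_poly n c) + smult (c (n - 1)) ?M"
      using word_poly_constacyclic_shift[OF assms(1), of \<mu> c] by simp
    then have "?M dvd pCons 0 p - word_poly n (constacyclic_shift n \<mu> c)"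
      using c(2) by (simp only: dvd_add dvd_mult dvd_smult dvd_refl)
    then show ?thesis
      using shift[OF c(1)] by (auto simp: J_def)
  qed
  have zero: "0 \<in> J"
    using lin(1) by (force simp: J_def intro!: bexI[of _ "\<lambda>_. 0"])
  have mult: "r * p \<in> J" if "p \<in> J" for p r
  proof (induction r)
    case (pCons a r)
    then show ?case
      using add[OF smult[OF that, of a] shift_mem[of "r * p"]] by simp
  qed (use zero in simp)
  have "ideal (residue_class n \<mu> ` J) (constacyclic_ring n \<mu>)"
    by (intro ideal_residue_classes zero add mult)
  moreover have "residue_class n \<mu> ` J = code_classes n \<mu> C"
  proof
    show "residue_class n \<mu> ` J \<subseteq> code_classes n \<mu> C"
      by (auto simp: J_def code_classes_def image_iff residue_class_eq_iff)
    show "code_classes n \<mu> C \<subseteq> residue_class n \<mu> ` J"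
      by (force simp: J_def code_classes_def)
  qed
  ultimately show ?thesis
    using assms by (simp add: constacyclic_code_def)
qed

section \<open>Codes generated by a divisor of \<open>x^n - \<mu>\<close>\<close>

text \<open>For a monic divisor of \<open>x^n - \<mu>\<close> this is the code denoted by
  \<open>code_generated_by\<close>; divisibility is easier to handle than ideals of residue
  classes.\<close>

definition poly_code :: "nat \<Rightarrow> 'a::field poly \<Rightarrow> (nat \<Rightarrow> 'a) set" where
  "poly_code n g = {c \<in> words n. g dvd word_poly n c}"

lemma linear_poly_code: "linear_code n (poly_code n g)"
proof -
  have "(\<lambda>j. c j + d j) \<in> poly_code n g" if "c \<in> poly_code n g" "d \<in> poly_code n g" for c d
    using that by (auto simp: poly_code_def word_poly_add words_def)
  moreover have "(\<lambda>j. a * c j) \<in> poly_code n g" if "c \<in> poly_code n g" for a c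
    using that by (auto simp: poly_code_def word_poly_scale words_def dvd_smult)
  ultimately show ?thesis
    by (auto simp: linear_code_iff) (auto simp: poly_code_def words_def)
qed

context
  fixes n :: nat and \<mu> :: "'a::field" and g :: "'a poly"
  assumes n: "n > 0" and \<mu>: "\<mu> \<noteq> 0" and dvd: "g dvd monom 1 n - [:\<mu>:]"
begin

lemma constacyclic_poly_code: "constacyclic_code n \<mu> (poly_code n g)"
proof (rule constacyclic_codeI[OF n \<mu> linear_poly_code])
  fix c assume "c \<in> poly_code n g"
  then have "g dvd [:0, 1:] * word_poly n c"
    by (simp only: poly_code_def mem_Collect_eq dvd_mult)
  then have "g dvd word_poly n (constacyclic_shift n \<mu> c)"
    unfolding word_poly_constacyclic_shift[OF n] using dvd_diff[OF _ dvd_smult[OF dvd]] by simp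
  then show "constacyclic_shift n \<mu> c \<in> poly_code n g"
    using n by (auto simp: poly_code_def words_def constacyclic_shift_def)
qed

lemma code_classes_poly_code:
  "code_classes n \<mu> (poly_code n g) = cgenideal (constacyclic_ring n \<mu>) (residue_class n \<mu> g)"
proof
  show "code_classes n \<mu> (poly_code n g) \<subseteq>
      cgenideal (constacyclic_ring n \<mu>) (residue_class n \<mu> g)"
    unfolding code_classes_def cgenideal_constacyclic_ring poly_code_def
    by (auto simp: dvd_def mult.commute[of g])
  show "cgenideal (constacyclic_ring n \<mu>) (residue_class n \<mu> g) \<subseteq> code_classes n \<mu> (poly_code n g)"
  proof
    let ?M = "monom 1 n - [:\<mu>:]"
    fix X assume "X \<in> cgenideal (constacyclic_ring n \<mu>) (residue_class n \<mu> g)"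
    then obtain u where X: "X = residue_class n \<mu> (u * g)"
      by (auto simp: cgenideal_constacyclic_ring)
    \<comment> \<open>The generator divides both \<open>u * g\<close> and the modulus, hence also
      this remainder, which is the polynomial of a word.\<close>
    define r where "r = (u * g) mod ?M"
    have "?M \<noteq> 0"
      using degree_modulus[OF n, of \<mu>] n by auto
    then have r: "r = 0 \<or> degree r < n"
      using degree_mod_less[of ?M "u * g"] degree_modulus[OF n, of \<mu>] by (auto simp: r_def)
    have "?M dvd u * g - r"
      by (simp add: r_def minus_mod_eq_mult_div)
    then have "X = residue_class n \<mu> (word_poly n (coeff r))"
      by (simp add: X residue_class_eq_iff word_poly_coeff[OF r])
    moreover have "g dvd r"
      using dvd by (simp add: r_def dvd_mod)
    ultimately show "X \<in> code_classes n \<mu> (poly_code n g)"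
      using coeff_in_words[OF r] word_poly_coeff[OF r] unfolding code_classes_def poly_code_def
      by (intro image_eqI[of _ _ "coeff r"]) auto
  qed
qed

lemma generator_poly_poly_code: "lead_coeff g = 1 \<Longrightarrow> generator_poly n \<mu> (poly_code n g) g"
  using dvd by (simp add: generator_poly_def code_classes_poly_code)

lemma code_generated_by_eq: "lead_coeff g = 1 \<Longrightarrow> code_generated_by n \<mu> g = poly_code n g"
  unfolding code_generated_by_def
proof (rule the_equality)
  fix C assume C: "constacyclic_code n \<mu> C \<and> generator_poly n \<mu> C g"
  then have "C \<subseteq> words n" "code_classes n \<mu> C = code_classes n \<mu> (poly_code n g)"
    unfolding code_classes_poly_code
    by (simp_all add: constacyclic_code_def linear_code_def generator_poly_def)
  then show "C = poly_code n g"
    by (intro code_classes_inj[OF n]) (auto simp: poly_code_def)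
qed (auto simp: constacyclic_poly_code generator_poly_poly_code)

lemma constacyclic_dual_poly_code: "constacyclic_code n (inverse \<mu>) (dual_code n (poly_code n g))"
proof (rule constacyclic_codeI)
  show "linear_code n (dual_code n (poly_code n g))"
    by (auto simp: linear_code_iff dual_code_def words_def distrib_left sum.distrib
        mult.left_commute[of _ a for a] simp flip: sum_distrib_left)
  obtain k where k: "n = Suc k"
    using n by (cases n) auto
  fix v assume v: "v \<in> dual_code n (poly_code n g)"
  have "(\<Sum>j<n. c j * constacyclic_shift n (inverse \<mu>) v j) = 0" if c: "c \<in> poly_code n g" for c
  proof -
    let ?M = "monom 1 n - [:\<mu>:]"
    \<comment> \<open>\<open>d\<close> is the shift of \<open>c\<close> in the opposite direction,
      that is, \<open>c / x\<close> modulo \<open>x^n - \<mu>\<close>. Shifting \<open>v\<close> by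
      \<open>inverse \<mu>\<close> is adjoint to this operation.\<close>
    define d where "d = (\<lambda>j. if j < k then c (Suc j) else if j = k then inverse \<mu> * c 0 else 0)"
    have shift: "pCons 0 (word_poly n d) = word_poly n c + smult (inverse \<mu> * c 0) ?M"
      by (intro poly_eqI)
        (use \<mu> in \<open>auto simp: coeff_pCons coeff_word_poly coeff_monom d_def k split: nat.splits\<close>)
    have "g dvd pCons 0 (word_poly n d)"
      unfolding shift using c dvd by (auto simp: poly_code_def intro!: dvd_add dvd_smult)
    \<comment> \<open>The factor \<open>x\<close> is cancelled by multiplying with
      \<open>x^(n-1)\<close>: modulo \<open>x^n - \<mu>\<close> the product \<open>x^n\<close> is
      the unit \<open>\<mu>\<close>.\<close>
    then have "g dvd monom 1 k * pCons 0 (word_poly n d) - ?M * word_poly n d"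
      using dvd by (metis dvd_diff dvd_mult dvd_mult2)
    also have "monom 1 k * pCons 0 (word_poly n d) - ?M * word_poly n d = smult \<mu> (word_poly n d)"
      by (simp add: k monom_Suc algebra_simps)
    finally have "g dvd word_poly n d"
      using \<mu> by (simp add: dvd_smult_iff)
    moreover have "d \<in> words n"
      by (simp add: words_def d_def k)
    ultimately have "(\<Sum>j<n. d j * v j) = 0"
      using v by (simp add: dual_code_def poly_code_def)
    moreover have "(\<Sum>j<n. c j * constacyclic_shift n (inverse \<mu>) v j) =
        c 0 * (inverse \<mu> * v k) + (\<Sum>j<k. c (Suc j) * v j)"
      by (simp add: k sum.lessThan_Suc_shift constacyclic_shift_def del: sum.lessThan_Suc)
    moreover have "(\<Sum>j<n. d j * v j) = (\<Sum>j<k. c (Suc j) * v j) + inverse \<mu> * c 0 * v k"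
      by (simp add: k d_def)
    ultimately show ?thesis
      by (simp add: mult_ac add.commute)
  qed
  then show "constacyclic_shift n (inverse \<mu>) v \<in> dual_code n (poly_code n g)"
    using n by (simp add: dual_code_def words_def constacyclic_shift_def)
qed (use n \<mu> in auto)

end

section \<open>The size of a polynomial code and of its dual\<close>

lemma poly_code_subset: "poly_code n g \<subseteq> words n"
  by (auto simp: poly_code_def)

lemma poly_code_quotient:
  assumes "c \<in> poly_code n g" "g \<noteq> 0"
  obtains u where "word_poly n c = g * u" "u = 0 \<or> degree u < n - degree g"
proof -
  obtain u where u: "word_poly n c = g * u"
    using assms(1) by (auto simp: poly_code_def elim!: dvdE)
  have "degree u < n - degree g" if "u \<noteq> 0"
  proof -
    have "n \<noteq> 0"
      using that assms(2) u by (cases n) auto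
    then have "degree (g * u) < n"
      unfolding u[symmetric] by (intro degree_word_poly) simp
    then show ?thesis
      using assms(2) that by (simp add: degree_mult_eq)
  qed
  with u that show thesis
    by blast
qed

text \<open>Multiplication by \<open>g\<close> is a bijection from the polynomials of degree below
  \<open>n - degree g\<close> onto the polynomials of codewords.\<close>

lemma card_poly_code:
  fixes g :: "'a::finite_field poly"
  assumes "g \<noteq> 0" "degree g \<le> n"
  shows "card (poly_code n g) = card (UNIV :: 'a set) ^ (n - degree g)"
proof -
  let ?k = "n - degree g"
  have "bij_betw (\<lambda>u. coeff (g * word_poly ?k u)) (words ?k) (poly_code n g)"
    unfolding bij_betw_def
  proof (intro conjI inj_onI)
    fix u v assume uv: "u \<in> words ?k" "v \<in> words ?k"
      and "coeff (g * word_poly ?k u) = coeff (g * word_poly ?k v)"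
    then have "g * word_poly ?k u = g * word_poly ?k v"
      by (simp add: coeff_inject)
    then show "u = v"
      using assms(1) uv by (metis mult_left_cancel coeff_word_poly_words)
  next
    show "(\<lambda>u. coeff (g * word_poly ?k u)) ` words ?k = poly_code n g"
    proof safe
      fix u :: "nat \<Rightarrow> 'a" assume "u \<in> words ?k"
      have "g * word_poly ?k u = 0 \<or> degree (g * word_poly ?k u) < n"
      proof (cases "word_poly ?k u = 0")
        case False
        then have "?k > 0"
          by (intro gr0I) simp
        then have "degree (word_poly ?k u) < ?k"
          by (rule degree_word_poly)
        then show ?thesis
          using degree_mult_le[of g "word_poly ?k u"] by linarith
      qed simp
      then show "coeff (g * word_poly ?k u) \<in> poly_code n g"
        by (simp add: poly_code_def coeff_in_words word_poly_coeff)
    next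
      fix c assume "c \<in> poly_code n g"
      then obtain u where c: "c \<in> words n" and u: "word_poly n c = g * u"
        and u': "u = 0 \<or> degree u < ?k"
        using assms(1) by (metis poly_code_quotient poly_code_subset subsetD)
      have "coeff u \<in> words ?k" "word_poly ?k (coeff u) = u"
        by (rule coeff_in_words[OF u'], rule word_poly_coeff[OF u'])
      moreover have "coeff (g * u) = c"
        using c by (simp add: u[symmetric] coeff_word_poly_words)
      ultimately show "c \<in> (\<lambda>u. coeff (g * word_poly ?k u)) ` words ?k"
        by (intro image_eqI[of _ _ "coeff u"]) simp_all
    qed
  qed
  then show ?thesis
    by (simp add: bij_betw_same_card[symmetric] card_words)
qed

lemma sum_coeff_monom_mult:
  assumes "k + degree g < n"
  shows "(\<Sum>j<n. coeff (monom a k * g) j * v j) = a * (\<Sum>j\<le>degree g. coeff g j * v (k + j))"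
proof -
  have "(\<Sum>j<n. coeff (monom a k * g) j * v j) =
      (\<Sum>j\<in>(\<lambda>i. k + i) ` {..degree g}. coeff (monom a k * g) j * v j)"
  proof (rule sum.mono_neutral_right)
    show "\<forall>j\<in>{..<n} - (\<lambda>i. k + i) ` {..degree g}. coeff (monom a k * g) j * v j = 0"
    proof
      fix j assume "j \<in> {..<n} - (\<lambda>i. k + i) ` {..degree g}"
      then have "\<not> j < k \<Longrightarrow> degree g < j - k"
        by (metis DiffE atMost_iff image_eqI le_add_diff_inverse linorder_not_less)
      then show "coeff (monom a k * g) j * v j = 0"
        by (auto simp: coeff_monom_mult coeff_eq_0)
    qed
  qed (use assms in auto)
  also have "\<dots> = (\<Sum>i\<le>degree g. coeff (monom a k * g) (k + i) * v (k + i))"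
    by (simp add: sum.reindex)
  also have "\<dots> = a * (\<Sum>j\<le>degree g. coeff g j * v (k + j))"
    by (simp add: coeff_monom_mult sum_distrib_left mult.assoc)
  finally show ?thesis .
qed

text \<open>A multiple of \<open>g\<close> of degree below \<open>n\<close> is a combination of the
  shifts \<open>x^k * g\<close> with \<open>k < n - degree g\<close>, and each hypothesis is
  orthogonality to one shift. The vector \<open>v\<close> is arbitrary, so that the lemma also
  serves over the extension field.\<close>

lemma orthogonal_multiples:
  fixes g u :: "'a::field poly"
  assumes rec: "\<And>k. k < n - degree g \<Longrightarrow> (\<Sum>j\<le>degree g. coeff g j * v (k + j)) = 0"
    and u: "u = 0 \<or> degree u < n - degree g"
  shows "(\<Sum>j<n. coeff (g * u) j * v j) = 0"
proof -
  let ?k = "n - degree g"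
  have "g * u = g * word_poly ?k (coeff u)"
    by (simp add: word_poly_coeff[OF u])
  also have "\<dots> = (\<Sum>k<?k. monom (coeff u k) k * g)"
    by (simp add: word_poly_def sum_distrib_left mult.commute)
  finally have "(\<Sum>j<n. coeff (g * u) j * v j) =
      (\<Sum>j<n. \<Sum>k<?k. coeff (monom (coeff u k) k * g) j * v j)"
    by (simp add: coeff_sum sum_distrib_right)
  also have "\<dots> = (\<Sum>k<?k. \<Sum>j<n. coeff (monom (coeff u k) k * g) j * v j)"
    by (rule sum.swap)
  also have "\<dots> = 0"
    by (rule sum.neutral, rule ballI) (subst sum_coeff_monom_mult, auto simp: rec)
  finally show ?thesis .
qed

text \<open>The dual words are the segments of length \<open>n\<close> of linear recurring sequences
  with the coefficients of \<open>g\<close>.\<close>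

lemma dual_poly_code:
  assumes "g \<noteq> 0" "degree g \<le> n"
  shows "dual_code n (poly_code n g) =
    {v \<in> words n. \<forall>k<n - degree g. (\<Sum>j\<le>degree g. coeff g j * v (k + j)) = 0}"
proof safe
  fix v k assume v: "v \<in> dual_code n (poly_code n g)" and k: "k < n - degree g"
  have "degree (monom 1 k * g) < n"
    using degree_mult_le[of "monom 1 k" g] degree_monom_le[of "1 :: 'a" k] k by linarith
  then have "coeff (monom 1 k * g) \<in> poly_code n g"
    by (simp add: poly_code_def coeff_in_words word_poly_coeff)
  then have "(\<Sum>j<n. coeff (monom 1 k * g) j * v j) = 0"
    using v by (simp add: dual_code_def)
  then show "(\<Sum>j\<le>degree g. coeff g j * v (k + j)) = 0"
    using sum_coeff_monom_mult[of k g n 1 v] k by simp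
next
  fix v assume v: "v \<in> words n"
    and rec: "\<forall>k<n - degree g. (\<Sum>j\<le>degree g. coeff g j * v (k + j)) = 0"
  have "(\<Sum>j<n. c j * v j) = 0" if c: "c \<in> poly_code n g" for c
  proof -
    obtain u where u: "word_poly n c = g * u" "u = 0 \<or> degree u < n - degree g"
      using c assms(1) by (rule poly_code_quotient)
    then have "(\<Sum>j<n. coeff (g * u) j * v j) = 0"
      using rec by (intro orthogonal_multiples) auto
    moreover have "coeff (g * u) = c"
      using c by (simp add: u(1)[symmetric] coeff_word_poly_words poly_code_def)
    ultimately show ?thesis
      by simp
  qed
  then show "v \<in> dual_code n (poly_code n g)"
    using v by (simp add: dual_code_def)
qed (auto simp: dual_code_def)

text \<open>The first \<open>t\<close> entries are free, and the leading coefficient 1 lets the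
  recurrence determine each later entry from the \<open>t\<close> entries before it.\<close>

lemma card_recurrence:
  fixes a :: "nat \<Rightarrow> 'a::finite_field"
  assumes "t \<le> n" "a t = 1"
  shows "card {v \<in> words n. \<forall>k<n - t. (\<Sum>j\<le>t. a j * v (k + j)) = 0} = card (UNIV :: 'a set) ^ t"
  using assms(1)
proof (induction n rule: dec_induct)
  case base
  then show ?case
    by (simp add: card_words)
next
  case (step n)
  let ?D = "\<lambda>n. {v \<in> words n. \<forall>k<n - t. (\<Sum>j\<le>t. a j * v (k + j)) = 0}"
  let ?ext = "\<lambda>w. w(n := - (\<Sum>j<t. a j * w (n - t + j)))"
  have sum: "(\<Sum>j\<le>t. a j * v (n - t + j)) = (\<Sum>j<t. a j * v (n - t + j)) + v n" for v
    using assms(2) step.hyps by (simp add: lessThan_Suc_atMost[symmetric])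
  have upd: "(\<Sum>j\<le>t. a j * (v(n := y)) (k + j)) = (\<Sum>j\<le>t. a j * v (k + j))"
    if "k < n - t" for v :: "nat \<Rightarrow> 'a" and y k
    using that by (intro sum.cong) auto
  have upd': "(\<Sum>j<t. a j * (v(n := y)) (n - t + j)) = (\<Sum>j<t. a j * v (n - t + j))"
    for v :: "nat \<Rightarrow> 'a" and y
    using step.hyps by (intro sum.cong) auto
  have less: "k < Suc n - t \<longleftrightarrow> k < n - t \<or> k = n - t" for k
    using step.hyps by auto
  have "bij_betw (\<lambda>v. v(n := 0)) (?D (Suc n)) (?D n)"
  proof (rule bij_betwI[where g = ?ext])
    show "(\<lambda>v. v(n := 0)) \<in> ?D (Suc n) \<rightarrow> ?D n"
      by (auto simp: upd words_def less simp del: fun_upd_apply) (auto simp: fun_upd_def)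
    show "?ext \<in> ?D n \<rightarrow> ?D (Suc n)"
      by (auto simp: upd upd' sum less simp del: fun_upd_apply) (auto simp: words_def)
    show "?ext (v(n := 0)) = v" if v: "v \<in> ?D (Suc n)" for v
    proof -
      have "(\<Sum>j<t. a j * v (n - t + j)) + v n = 0"
        using v by (simp add: less sum[symmetric])
      then show ?thesis
        by (auto simp only: upd' fun_upd_upd) (simp add: fun_eq_iff add_eq_0_iff)
    qed
    show "(?ext w)(n := 0) = w" if "w \<in> ?D n" for w
      using that by (auto simp: words_def fun_eq_iff)
  qed
  then show ?case
    using step.IH by (simp add: bij_betw_same_card)
qed

lemma card_dual_poly_code:
  fixes g :: "'a::finite_field poly"
  assumes "lead_coeff g = 1" "degree g \<le> n"
  shows "card (dual_code n (poly_code n g)) = card (UNIV :: 'a set) ^ degree g"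
proof -
  have "g \<noteq> 0"
    using assms(1) by auto
  then show ?thesis
    using card_recurrence[OF assms(2), of "coeff g"] assms by (simp add: dual_poly_code)
qed

text \<open>A root \<open>z\<close> of \<open>x^n - \<mu>\<close> that is not a root of \<open>g\<close> yields a zero of the dual code: the
  polynomial \<open>(x^n - z^n) / (x - z)\<close> is then a multiple of \<open>g\<close>, and its coefficients are the powers of \<open>z\<close>
  in descending order.\<close>

lemma dual_poly_code_zero:
  fixes g :: "'a::field poly" and emb :: "'a \<Rightarrow> 'b::field"
  assumes emb: "field_embedding emb" and "n > 0" and dvd: "g dvd monom 1 n - [:\<mu>:]"
    and z: "z ^ n = emb \<mu>" "z \<noteq> 0" "poly (map_poly emb g) z \<noteq> 0"
    and v: "v \<in> dual_code n (poly_code n g)"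
  shows "(\<Sum>j<n. emb (v j) * inverse z ^ j) = 0"
proof -
  let ?G = "map_poly emb g"
  let ?H = "\<Sum>i<n. [:z:] ^ (n - Suc i) * monom 1 1 ^ i"
  have "monom 1 n - [:emb \<mu>:] = monom 1 1 ^ n - [:z:] ^ n"
    using z(1) by (simp add: monom_power poly_const_pow)
  also have "\<dots> = (monom 1 1 - [:z:]) * ?H"
    by (rule power_diff_sumr2)
  also have "monom 1 1 - [:z:] = [:- z, 1:]"
    by (simp add: monom_altdef)
  finally have fact: "monom 1 n - [:emb \<mu>:] = [:- z, 1:] * ?H" .
  have "map_poly emb (monom 1 n - [:\<mu>:]) = monom 1 n - [:emb \<mu>:]"
    using emb by (simp add: map_poly_embedding_diff map_poly_embedding_monom field_embedding_1
        map_poly_pCons field_embedding_0)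
  then have "?G dvd [:- z, 1:] * ?H"
    using dvd fact by (metis map_poly_embedding_dvd_iff[OF emb])
  then obtain U where U: "[:- z, 1:] * ?H = ?G * U"
    by (elim dvdE)
  have "poly ?G z * poly U z = poly ([:- z, 1:] * ?H) z"
    unfolding U by simp
  \<comment> \<open>The left side vanishes at \<open>z\<close> and the image of \<open>g\<close>
    does not, so the factor \<open>x - z\<close> must sit in the cofactor \<open>U\<close>.
    Cancelling it shows that the image of \<open>g\<close> divides \<open>?H\<close> itself.\<close>
  then have "poly U z = 0"
    using z(3) by simp
  then obtain W where W: "U = [:- z, 1:] * W"
    by (metis dvdE poly_eq_0_iff_dvd)
  have "[:- z, 1:] * ?H = [:- z, 1:] * (?G * W)"
    using U W by (simp only: mult.left_commute)
  then have H: "?H = ?G * W"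
    by (rule iffD1[OF mult_left_cancel, rotated]) simp
  have coeff_H: "coeff ?H j = z ^ (n - Suc j)" if "j < n" for j
    using that by (simp add: coeff_sum monom_power poly_const_pow coeff_monom if_distrib cong: if_cong)
  have coeff_H': "coeff ?H j = 0" if "j \<ge> n" for j
    using that by (simp add: coeff_sum monom_power poly_const_pow coeff_monom)
  have "g \<noteq> 0"
    using z(3) by auto
  have degG: "degree ?G = degree g"
    by (rule degree_map_poly_embedding[OF emb])
  have "degree ?H < n"
    using coeff_H' \<open>n > 0\<close> by (intro degree_lessI) auto
  moreover have "?H \<noteq> 0"
    using coeff_H[of 0] \<open>n > 0\<close> z(2) by auto
  ultimately have "degree ?G + degree W < n"
    unfolding H by (simp add: degree_mult_eq)
  then have W_deg: "degree W < n - degree ?G"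
    by simp
  have "(\<Sum>j\<le>degree ?G. coeff ?G j * emb (v (k + j))) = 0" if k: "k < n - degree ?G" for k
  proof -
    have "(\<Sum>j\<le>degree g. coeff g j * v (k + j)) = 0"
      using v k \<open>degree ?G + degree W < n\<close> \<open>g \<noteq> 0\<close> by (simp add: dual_poly_code degG)
    then have "emb (\<Sum>j\<le>degree g. coeff g j * v (k + j)) = 0"
      by (simp add: field_embedding_0[OF emb])
    then show ?thesis
      by (simp add: degG coeff_map_poly_embedding[OF emb] field_embedding_sum[OF emb]
          field_embedding_mult[OF emb])
  qed
  then have "(\<Sum>j<n. coeff (?G * W) j * emb (v j)) = 0"
    using W_deg by (intro orthogonal_multiples) auto
  then have "(\<Sum>j<n. coeff ?H j * emb (v j)) = 0"
    unfolding H .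
  moreover have "(\<Sum>j<n. coeff ?H j * emb (v j)) = (\<Sum>j<n. z ^ (n - Suc j) * emb (v j))"
    by (intro sum.cong refl) (simp only: coeff_H lessThan_iff)
  ultimately have zero: "(\<Sum>j<n. z ^ (n - Suc j) * emb (v j)) = 0"
    by (simp only:)
  have pow: "z ^ (n - Suc j) = z ^ (n - 1) * inverse z ^ j" if "j < n" for j
  proof -
    have "z ^ (n - 1) = z ^ (n - Suc j) * z ^ j"
      using that by (simp flip: power_add)
    then show ?thesis
      using z(2) by (simp add: field_simps)
  qed
  \<comment> \<open>Taking out \<open>z ^ (n - 1)\<close> turns the descending powers of
    \<open>z\<close> into ascending powers of its inverse.\<close>
  have "z ^ (n - 1) * (\<Sum>j<n. emb (v j) * inverse z ^ j) = (\<Sum>j<n. z ^ (n - Suc j) * emb (v j))"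
    unfolding sum_distrib_left by (intro sum.cong refl) (simp only: pow lessThan_iff ac_simps)
  also have "\<dots> = 0"
    by (rule zero)
  finally have "z ^ (n - 1) * (\<Sum>j<n. emb (v j) * inverse z ^ j) = 0" .
  then show ?thesis
    using z(2) by simp
qed

section \<open>Exponents of the roots\<close>

text \<open>The division in \<open>code_length\<close> is exact. With \<open>l\<close> for
  \<open>m\<close> this also covers the term \<open>(q^l - 1) / (q - 1)\<close> of the dual
  bound.\<close>

lemma code_length_mult: "q > 0 \<Longrightarrow> (q - 1) * code_length q m = q ^ m - 1"
proof -
  assume q: "q > 0"
  have "q - 1 dvd q ^ m - 1"
  proof (induction m)
    case (Suc m)
    have "q ^ Suc m - 1 = q * (q ^ m - 1) + (q - 1)"
      using q by (simp add: algebra_simps Suc_leI)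
    then show ?case
      using Suc by simp
  qed simp
  then show ?thesis
    by (simp add: code_length_def)
qed

lemma wt_eq_mod:
  assumes "i < q ^ m"
  obtains k where "i = wt q m i + (q - 1) * k"
  using assms
proof (induction m arbitrary: i thesis)
  case 0
  then show ?case
    using "0.prems"(1)[of 0] by simp
next
  case (Suc m)
  have q: "q > 0"
    using Suc.prems(2) by (cases "q = 0") auto
  have "i div q < q ^ m"
    using Suc.prems(2) q by (simp add: div_less_iff_less_mult mult.commute)
  then obtain k where k: "i div q = wt q m (i div q) + (q - 1) * k"
    using Suc.IH by blast
  obtain p where p: "q = Suc p"
    using q by (cases q) auto
  have "i = i mod q + q * (i div q)"
    by simp
  also have "q * (i div q) = i div q + (q - 1) * (i div q)"
    by (simp add: p)
  finally have "i = wt q (Suc m) i + (q - 1) * (k + i div q)"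
    using k by (simp add: wt_Suc algebra_simps)
  then show ?case
    by (rule Suc.prems(1))
qed

text \<open>Since \<open>q = 1\<close> modulo \<open>q - 1\<close>, an integer is congruent to its
  digit sum. Exponents of this form are those for which \<open>\<beta> ^ i\<close> is a root of
  \<open>x^n - \<lambda>\<close>.\<close>

lemma T_set_mod:
  assumes "q > 2" "i \<in> T_set q m l"
  obtains k where "i = 1 + (q - 1) * k"
proof -
  have i: "i < q ^ m" "wt q m i = 1 + (q - 1) * l"
    using assms by (simp_all add: T_set_conv)
  obtain k where "i = wt q m i + (q - 1) * k"
    using wt_eq_mod[OF i(1)] by blast
  then have "i = 1 + (q - 1) * (l + k)"
    unfolding i(2) by (simp add: distrib_left)
  then show thesis
    by (rule that)
qed

text \<open>The element \<open>i'\<close> is the cyclic shift of the digits of \<open>i\<close>, and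
  \<open>k\<close> is the leading digit that wraps around.\<close>

lemma T_set_shift:
  assumes "q > 2" "m > 0" "i \<in> T_set q m l"
  obtains i' k where "i' \<in> T_set q m l" "i * q = i' + (q ^ m - 1) * k"
proof -
  obtain p where m: "m = Suc p"
    using assms(2) by (cases m) auto
  let ?a = "i mod q ^ p" and ?d = "i div q ^ p"
  have i: "i < q ^ Suc p"
    using assms(3) by (simp add: T_set_conv[OF assms(1)] m)
  have "?a < q ^ p"
    using assms(1) by simp
  then have "q * (?a + 1) \<le> q * q ^ p"
    by (intro mult_le_mono2) simp
  moreover have "?d < q"
    using i assms(1) by (simp add: div_less_iff_less_mult)
  ultimately have "q * ?a + ?d < q ^ m"
    by (simp add: m)
  then have mem: "q * ?a + ?d \<in> T_set q m l"
    using assms(3) wt_shift[OF i] by (simp add: T_set_conv[OF assms(1)] m)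
  have "i * q = (?a + q ^ p * ?d) * q"
    by simp
  also have "\<dots> = q * ?a + q ^ m * ?d"
    unfolding m by (simp only: power_Suc algebra_simps)
  also have "q ^ m * ?d = ?d + (q ^ m - 1) * ?d"
    using assms(1) by (simp add: diff_mult_distrib)
  finally have "i * q = (q * ?a + ?d) + (q ^ m - 1) * ?d"
    by simp
  with mem show thesis
    by (rule that)
qed

lemma digit_append_less:
  fixes a b q :: nat
  assumes "a < q ^ h" "b < q ^ k"
  shows "a + q ^ h * b < q ^ (h + k)"
proof -
  have "a + q ^ h * b < q ^ h * (b + 1)"
    using assms(1) by simp
  also have "\<dots> \<le> q ^ h * q ^ k"
    using assms(2) by (intro mult_le_mono2) simp
  finally show ?thesis
    by (simp add: power_add)
qed

lemma wt_least: "1 \<le> c \<Longrightarrow> c \<le> q \<Longrightarrow> s < m \<Longrightarrow> wt q m (c * q ^ s - 1) = c - 1 + (q - 1) * s"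
  using wt_no_carry[of c q 0 s m] by simp

lemma mult_power_le: "c \<le> q \<Longrightarrow> s < m \<Longrightarrow> c * q ^ s \<le> (q :: nat) ^ m"
proof -
  assume c: "c \<le> q" and s: "s < m"
  have "c * q ^ s \<le> q ^ Suc s"
    using c by simp
  also have "\<dots> \<le> q ^ m"
    using s by (cases "q = 0") (auto simp del: power_Suc intro!: power_increasing)
  finally show ?thesis .
qed

lemma least_in_T_set:
  assumes "q > 2" "l < m"
  shows "2 * q ^ l - 1 \<in> T_set q m l"
proof -
  have "2 * q ^ l \<le> q ^ m" "q ^ l > 0"
    using mult_power_le[of 2 q l m] assms by simp_all
  then have "2 * q ^ l - 1 < q ^ m"
    by linarith
  then show ?thesis
    using wt_least[of 2 q l m] assms by (simp add: T_set_conv)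
qed

text \<open>Adding \<open>q ^ h - 1\<close> moves one unit from the lowest \<open>h\<close> digits to the next \<open>h\<close> digits. As long as no
  carry occurs, this does not change the digit sum.\<close>

lemma wt_progression:
  assumes "1 \<le> c" "c \<le> q" "t < h \<or> c = 1 \<and> t = h" "s < c * q ^ t" "A < q ^ k"
  defines "i \<equiv> c * q ^ t - 1 + q ^ (2 * h) * A + (q ^ h - 1) * s"
  shows "wt q (2 * h + k) i = c - 1 + (q - 1) * t + wt q k A" and "i < q ^ (2 * h + k)"
proof -
  have le: "c * q ^ t \<le> q ^ h"
    using assms(3) mult_power_le[OF assms(2)] by auto
  \<comment> \<open>After \<open>s\<close> steps the lowest block is \<open>?a\<close> and the
    second block is \<open>s\<close>. Both stay below \<open>q ^ h\<close>, and by
    \<open>wt_no_carry\<close> their digit sums add up to a constant.\<close>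
  let ?a = "c * q ^ t - 1 - s"
  have a: "?a < q ^ h" and s: "s < q ^ h"
    using le assms(4) by auto
  obtain p where p: "q ^ h = Suc p"
    using s by (cases "q ^ h") auto
  have "q ^ h * (s + q ^ h * A) = s + (q ^ h - 1) * s + q ^ (2 * h) * A"
    by (simp only: mult_2 power_add p) (simp add: algebra_simps)
  moreover have "c * q ^ t - 1 = ?a + s"
    using assms(4) by simp
  ultimately have i: "i = ?a + q ^ h * (s + q ^ h * A)"
    unfolding i_def by linarith
  have eq: "2 * h + k = h + (h + k)"
    by simp
  have "wt q (2 * h + k) i = wt q h ?a + wt q h s + wt q k A"
    unfolding i eq by (simp only: wt_split[OF a] wt_split[OF s] add.assoc)
  also have "wt q h ?a + wt q h s = c - 1 + (q - 1) * t"
    using assms by (intro wt_no_carry) auto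
  finally show "wt q (2 * h + k) i = c - 1 + (q - 1) * t + wt q k A" .
  show "i < q ^ (2 * h + k)"
    unfolding i eq using a s assms(5) by (intro digit_append_less)
qed

lemma power_power_eq_self:
  assumes "z ^ (q ^ k) = (z :: 'a::monoid_mult)"
  shows "z ^ (q ^ (k * x)) = z"
proof (induction x)
  case (Suc x)
  have "z ^ (q ^ (k * Suc x)) = (z ^ (q ^ k)) ^ (q ^ (k * x))"
    by (simp add: power_add flip: power_mult)
  then show ?case
    using Suc assms by simp
qed simp

text \<open>By Bezout some multiple of \<open>h\<close> exceeds a multiple of \<open>m\<close> by
  one, so the fixing iterates of Frobenius leave a single Frobenius that fixes
  \<open>z\<close>.\<close>

lemma coprime_frobenius_fixed:
  assumes "z ^ (q ^ h) = (z :: 'a::monoid_mult)" "z ^ (q ^ m) = z" "coprime h m" "h > 0"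
  shows "z ^ q = z"
proof -
  obtain x y where "h * x = m * y + 1"
    using bezout_nat[of h m] assms(3,4) by auto
  then have "q ^ (h * x) = q ^ (m * y) * q"
    by simp
  then have "z ^ (q ^ (h * x)) = (z ^ (q ^ (m * y))) ^ q"
    by (simp only: power_mult[of z])
  then show ?thesis
    using power_power_eq_self[OF assms(1), of x] power_power_eq_self[OF assms(2), of y] by simp
qed

section \<open>The code and its dual\<close>

context
  fixes q m :: nat and emb :: "'a::finite_field \<Rightarrow> 'b::finite_field" and lam :: 'a and \<beta> :: 'b
  assumes q: "q > 2" and m: "m \<ge> 2"
    and card_a: "card (UNIV :: 'a set) = q" and card_b: "card (UNIV :: 'b set) = q ^ m"
    and emb: "field_embedding emb"
    and prim: "primitive_element lam" "primitive_element \<beta>"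
    and lam: "\<beta> ^ code_length q m = emb lam"
begin

lemma beta_nz: "\<beta> \<noteq> 0" and beta_order: "\<beta> ^ (q ^ m - 1) = 1"
  and beta_inj: "inj_on (\<lambda>i. \<beta> ^ i) {..<q ^ m - 1}"
  using primitive_element_power_card[OF prim(2), of "q ^ m - 1"] card_b by auto

lemma length_pos: "code_length q m > 0"
proof -
  have "q ^ m > 1"
    using one_less_power[of q m] q m by simp
  then show ?thesis
    using code_length_mult[of q m] q by (intro gr0I) auto
qed

lemma length_mult: "(q - 1) * code_length q m = q ^ m - 1"
  using q by (intro code_length_mult) simp

lemma mult_less_period_iff: "(q - 1) * k < q ^ m - 1 \<longleftrightarrow> k < code_length q m"
  unfolding length_mult[symmetric] using q by simp

lemma lam_nz: "lam \<noteq> 0"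
  using lam beta_nz field_embedding_eq_0_iff[OF emb, of lam] by auto

lemma beta_power_eq_iff:
  "i < q ^ m - 1 \<Longrightarrow> j < q ^ m - 1 \<Longrightarrow> \<beta> ^ i = \<beta> ^ j \<longleftrightarrow> i = j"
  using beta_inj by (auto simp: inj_on_def)

lemma beta_power_add_period: "\<beta> ^ (i + (q ^ m - 1) * k) = \<beta> ^ i"
  by (simp only: power_add power_mult beta_order power_one mult_1_right)

lemma beta_power_length: "(\<beta> ^ (1 + (q - 1) * k)) ^ code_length q m = emb lam"
proof -
  have "(1 + (q - 1) * k) * code_length q m = code_length q m + (q ^ m - 1) * k"
    unfolding length_mult[symmetric] by (simp only: distrib_right mult_1_left mult.assoc mult.commute[of k])
  then show ?thesis
    by (simp only: beta_power_add_period lam flip: power_mult)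
qed

lemma T_set_inj: "inj_on (\<lambda>i. \<beta> ^ i) (T_set q m l)"
  by (rule inj_on_subset[OF beta_inj]) (auto simp: T_set_def)

text \<open>Existence of the preimage comes from descent, as multiplication by \<open>q\<close>
  permutes the exponents; uniqueness comes from the injectivity of \<open>emb\<close>.\<close>

lemma map_T_poly: "map_poly emb (T_poly emb q m l \<beta>) = (\<Prod>i\<in>T_set q m l. [:- (\<beta> ^ i), 1:])"
proof -
  let ?R = "(\<lambda>i. \<beta> ^ i) ` T_set q m l"
  have "(\<lambda>x. x ^ q) ` ?R \<subseteq> ?R"
  proof clarify
    fix i assume i: "i \<in> T_set q m l"
    obtain i' k where "i' \<in> T_set q m l" "i * q = i' + (q ^ m - 1) * k"
      using T_set_shift[OF q _ i] m by auto
    then have "(\<beta> ^ i) ^ q = \<beta> ^ i'" "i' \<in> T_set q m l"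
      by (simp_all only: beta_power_add_period flip: power_mult)
    then show "(\<beta> ^ i) ^ q \<in> ?R"
      by blast
  qed
  moreover have "inj_on (\<lambda>x. x ^ q) ?R"
    by (rule inj_on_subset[OF field_embedding_inj[OF field_embedding_frobenius[OF emb card_a]]]) simp
  ultimately have R: "(\<lambda>x. x ^ q) ` ?R = ?R"
    by (intro endo_inj_surj) auto
  have "finite ?R"
    by simp
  then obtain g where "map_poly emb g = (\<Prod>x\<in>?R. [:- x, 1:])"
    using R by (rule prod_linear_factors_descent[OF emb card_a])
  note this
  also have "\<dots> = (\<Prod>i\<in>T_set q m l. [:- (\<beta> ^ i), 1:])"
    by (simp add: prod.reindex[OF T_set_inj])
  finally have g: "map_poly emb g = (\<Prod>i\<in>T_set q m l. [:- (\<beta> ^ i), 1:])" .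
  show ?thesis
    unfolding T_poly_def by (rule theI[of _ g], rule g) (metis g injD map_poly_embedding_inj[OF emb])
qed

lemma degree_T_poly: "degree (T_poly emb q m l \<beta>) = card (T_set q m l)"
  using degree_map_poly_embedding[OF emb, of "T_poly emb q m l \<beta>"]
  by (simp add: map_T_poly degree_prod_linear_factors)

lemma lead_coeff_T_poly: "lead_coeff (T_poly emb q m l \<beta>) = 1"
proof -
  have "emb (lead_coeff (T_poly emb q m l \<beta>)) = emb 1"
    using lead_coeff_prod_linear_factors[of "\<lambda>i. \<beta> ^ i" "T_set q m l"]
    by (metis map_T_poly coeff_map_poly_embedding degree_map_poly_embedding emb field_embedding_1)
  then show ?thesis
    using field_embedding_inj[OF emb] by (simp add: inj_eq)
qed

lemma T_poly_dvd: "T_poly emb q m l \<beta> dvd monom 1 (code_length q m) - [:lam:]"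
proof -
  let ?M = "monom 1 (code_length q m) - [:emb lam:] :: 'b poly"
  have "(\<Prod>i\<in>T_set q m l. [:- (\<beta> ^ i), 1:]) dvd ?M"
  proof (rule prod_linear_factors_dvd[OF _ T_set_inj])
    fix i assume "i \<in> T_set q m l"
    then obtain k where "i = 1 + (q - 1) * k"
      using T_set_mod[OF q] by blast
    then show "poly ?M (\<beta> ^ i) = 0"
      using beta_power_length[of k] by (simp add: poly_monom)
  qed simp
  also have "?M = map_poly emb (monom 1 (code_length q m) - [:lam:])"
    using emb by (simp add: map_poly_embedding_diff map_poly_embedding_monom field_embedding_1
        map_poly_pCons field_embedding_0)
  finally show ?thesis
    unfolding map_T_poly[symmetric] by (simp add: map_poly_embedding_dvd_iff[OF emb])
qed

lemma T_code_eq: "T_code emb q m l lam \<beta> = poly_code (code_length q m) (T_poly emb q m l \<beta>)"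
  unfolding T_code_def
  by (rule code_generated_by_eq[OF length_pos lam_nz T_poly_dvd lead_coeff_T_poly])

text \<open>The sets for different \<open>l\<close> are disjoint and lie among the \<open>n\<close>
  exponents congruent to 1 modulo \<open>q - 1\<close>; as \<open>m \<ge> 2\<close>, some other set
  has an element. The strict inequality makes the code nonzero, so that its minimum distance is
  meaningful.\<close>

lemma card_T_set_less:
  assumes "l < m"
  shows "card (T_set q m l) < code_length q m"
proof -
  let ?J = "(\<lambda>k. 1 + (q - 1) * k) ` {..<code_length q m}"
  have sub: "T_set q m l' \<subseteq> ?J" for l'
  proof
    fix i assume i: "i \<in> T_set q m l'"
    then obtain k where k: "i = 1 + (q - 1) * k"
      using T_set_mod[OF q] by blast
    have "(q - 1) * k < q ^ m - 1"
      using i k by (simp add: T_set_def)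
    then show "i \<in> ?J"
      using k by (intro image_eqI[of _ _ k]) (simp_all only: mult_less_period_iff lessThan_iff)
  qed
  define l' where "l' = (if l = 0 then 1 else 0 :: nat)"
  have l': "l' < m" "l' \<noteq> l"
    using m by (auto simp: l'_def)
  let ?i = "2 * q ^ l' - 1"
  have "?i \<in> T_set q m l'"
    by (rule least_in_T_set[OF q l'(1)])
  moreover from this have "?i \<notin> T_set q m l"
    using l'(2) q by (auto simp: T_set_def)
  ultimately have "T_set q m l \<subset> ?J"
    using sub by blast
  then have "card (T_set q m l) < card ?J"
    by (intro psubset_card_mono) auto
  also have "card ?J = code_length q m"
    using q by (subst card_image) (auto simp: inj_on_def)
  finally show ?thesis .
qed

lemma linear_T_code: "linear_code (code_length q m) (T_code emb q m l lam \<beta>)"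
  by (simp add: T_code_eq linear_poly_code)

lemma linear_dual_T_code:
  "linear_code (code_length q m) (dual_code (code_length q m) (T_code emb q m l lam \<beta>))"
  using constacyclic_dual_poly_code[OF length_pos lam_nz T_poly_dvd]
  by (simp add: T_code_eq constacyclic_code_def)

lemma card_T_code:
  assumes "l < m"
  shows "card (T_code emb q m l lam \<beta>) = q ^ (code_length q m - card (T_set q m l))"
proof -
  have "T_poly emb q m l \<beta> \<noteq> 0"
    using lead_coeff_T_poly[of l] by auto
  then show ?thesis
    using card_poly_code[of "T_poly emb q m l \<beta>" "code_length q m"] card_T_set_less[OF assms]
    by (simp add: T_code_eq degree_T_poly card_a)
qed

lemma card_dual_T_code:
  assumes "l < m"
  shows "card (dual_code (code_length q m) (T_code emb q m l lam \<beta>)) = q ^ card (T_set q m l)"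
  using card_dual_poly_code[OF lead_coeff_T_poly, of l "code_length q m"] card_T_set_less[OF assms]
  by (simp add: T_code_eq degree_T_poly card_a)

lemma nontrivial_if_card:
  assumes "linear_code k C" "card C = q ^ d" "d > 0"
  shows "\<exists>c\<in>C. c \<noteq> (\<lambda>_. 0 :: 'c::field)"
proof (rule ccontr)
  assume "\<not> ?thesis"
  then have "C = {\<lambda>_. 0}"
    using linear_code_zero[OF assms(1)] by blast
  then have "q ^ d = 1"
    using assms(2) by simp
  then show False
    using q assms(3) by simp
qed

lemma T_code_zero:
  assumes "c \<in> T_code emb q m l lam \<beta>" "i \<in> T_set q m l"
  shows "(\<Sum>j<code_length q m. emb (c j) * (\<beta> ^ i) ^ j) = 0"
proof -
  obtain u where u: "word_poly (code_length q m) c = T_poly emb q m l \<beta> * u"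
    using assms(1) by (auto simp: T_code_eq poly_code_def elim: dvdE)
  have "map_poly emb (word_poly (code_length q m) c) = (\<Sum>j<code_length q m. monom (emb (c j)) j)"
    by (intro poly_eqI)
      (auto simp: coeff_map_poly_embedding[OF emb] coeff_word_poly coeff_sum coeff_monom
        field_embedding_0[OF emb])
  moreover have "poly (map_poly emb (T_poly emb q m l \<beta> * u)) (\<beta> ^ i) = 0"
    using assms(2) by (auto simp: map_poly_embedding_mult[OF emb] map_T_poly poly_prod)
  ultimately show ?thesis
    by (simp add: u[symmetric] poly_sum poly_monom)
qed

lemma T_code_distance:
  assumes "l < m" and zeros: "\<And>s. s < d \<Longrightarrow> \<exists>i\<in>T_set q m l. \<beta> ^ i = x * y ^ s"
    and "x \<noteq> 0" and inj: "inj_on (\<lambda>j. y ^ j) {..<code_length q m}"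
  shows "d + 1 \<le> min_distance (code_length q m) (T_code emb q m l lam \<beta>)"
proof (rule min_distance_ge[OF linear_T_code])
  show "\<exists>c\<in>T_code emb q m l lam \<beta>. c \<noteq> (\<lambda>_. 0)"
    using card_T_set_less[OF assms(1)]
    by (intro nontrivial_if_card[OF linear_T_code card_T_code[OF assms(1)]]) simp
  fix c assume c: "c \<in> T_code emb q m l lam \<beta>" "c \<noteq> (\<lambda>_. 0)"
  have "(\<Sum>j<code_length q m. emb (c j) * (x * y ^ s) ^ j) = 0" if s: "s < d" for s
    using zeros[OF s] T_code_zero[OF c(1)] by metis
  then show "d + 1 \<le> card {j. j < code_length q m \<and> c j \<noteq> 0}"
    using c linear_code_subset[OF linear_T_code] by (intro bch_bound[OF emb _ assms(3) inj]) auto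
qed

section \<open>Lower bounds for the minimum distances\<close>

lemma progression_inj:
  assumes "coprime h m" "h > 0"
  shows "inj_on (\<lambda>j. (\<beta> ^ (q ^ h - 1)) ^ j) {..<code_length q m}"
proof -
  have ne: "(\<beta> ^ (q ^ h - 1)) ^ j \<noteq> (\<beta> ^ (q ^ h - 1)) ^ j'" if j: "j < j'" "j' < code_length q m" for j j'
  proof
    assume eq: "(\<beta> ^ (q ^ h - 1)) ^ j = (\<beta> ^ (q ^ h - 1)) ^ j'"
    define z where "z = \<beta> ^ (j' - j)"
    have "(\<beta> ^ (q ^ h - 1)) ^ j' = (\<beta> ^ (q ^ h - 1)) ^ j * (\<beta> ^ (q ^ h - 1)) ^ (j' - j)"
      using j by (simp flip: power_add)
    then have "(\<beta> ^ (q ^ h - 1)) ^ (j' - j) = 1"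
      using eq beta_nz by simp
    then have "z ^ (q ^ h - 1) = 1"
      by (simp add: z_def mult.commute flip: power_mult)
    then have "z * z ^ (q ^ h - 1) = z"
      by simp
    then have 1: "z ^ (q ^ h) = z"
      using q by (simp flip: power_Suc)
    have 2: "z ^ (q ^ m) = z"
      using finite_field_power_card_eq_same[of z] card_b by simp
    \<comment> \<open>So \<open>z\<close> lies in GF(q), which makes
      \<open>\<beta> ^ ((q - 1) * (j' - j))\<close> equal to 1 although the exponent is positive and
      below the order of \<open>\<beta>\<close>.\<close>
    have "z ^ q = z"
      by (rule coprime_frobenius_fixed[OF 1 2 assms])
    moreover have "z ^ q = z * z ^ (q - 1)"
      using q by (simp flip: power_Suc)
    ultimately have "z ^ (q - 1) = 1"
      using beta_nz by (simp add: z_def)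
    then have "\<beta> ^ ((q - 1) * (j' - j)) = \<beta> ^ 0"
      by (simp add: z_def mult.commute flip: power_mult)
    moreover have less: "(q - 1) * (j' - j) < q ^ m - 1"
      unfolding mult_less_period_iff using j by simp
    ultimately have "(q - 1) * (j' - j) = 0"
      using beta_power_eq_iff[OF less, of 0] less by (simp del: power_0)
    then show False
      using j q by simp
  qed
  show ?thesis
    by (rule linorder_inj_onI) (use ne in auto)
qed

lemma T_code_distance_low:
  assumes "coprime h m" "2 * h \<le> m" "l < h"
  shows "2 * q ^ l + 1 \<le> min_distance (code_length q m) (T_code emb q m l lam \<beta>)"
proof (rule T_code_distance)
  show "inj_on (\<lambda>j. (\<beta> ^ (q ^ h - 1)) ^ j) {..<code_length q m}"
    using assms by (intro progression_inj) auto
  fix s assume s: "s < 2 * q ^ l"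
  have "2 * q ^ l - 1 + (q ^ h - 1) * s \<in> T_set q m l"
    using wt_progression[of 2 q l h s 0 "m - 2 * h"] assms s q by (simp add: T_set_conv)
  then show "\<exists>i\<in>T_set q m l. \<beta> ^ i = \<beta> ^ (2 * q ^ l - 1) * (\<beta> ^ (q ^ h - 1)) ^ s"
    by (auto intro!: bexI[rotated] simp: power_add power_mult)
qed (use assms beta_nz in auto)

lemma T_code_distance_middle:
  assumes "coprime h m" "h > 0" "h \<le> l" "l < m - h"
  shows "q ^ h + 1 \<le> min_distance (code_length q m) (T_code emb q m l lam \<beta>)"
proof (rule T_code_distance)
  show "inj_on (\<lambda>j. (\<beta> ^ (q ^ h - 1)) ^ j) {..<code_length q m}"
    using assms by (intro progression_inj) auto
  \<comment> \<open>The lower block uses up \<open>(q - 1) * h\<close> of the digit sum.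
    \<open>?A\<close> is the least integer with the remaining sum
    \<open>1 + (q - 1) * (l - h)\<close>; it fits into the upper digits exactly because
    \<open>l < m - h\<close>.\<close>
  let ?A = "2 * q ^ (l - h) - 1" and ?k = "m - 2 * h"
  have k: "l - h < ?k" "2 * h + ?k = m"
    using assms by auto
  have A: "wt q ?k ?A = 1 + (q - 1) * (l - h)" "?A < q ^ ?k"
    using least_in_T_set[OF q k(1)] by (auto simp: T_set_conv[OF q])
  have l: "(q - 1) * h + (q - 1) * (l - h) = (q - 1) * l"
    using assms(3) by (simp flip: distrib_left)
  fix s assume s: "s < q ^ h"
  have "q ^ h - 1 + q ^ (2 * h) * ?A + (q ^ h - 1) * s \<in> T_set q m l"
    using wt_progression[of 1 q h h s ?A ?k] A s q l by (simp add: T_set_conv k(2))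
  then show "\<exists>i\<in>T_set q m l. \<beta> ^ i = \<beta> ^ (q ^ h - 1 + q ^ (2 * h) * ?A) * (\<beta> ^ (q ^ h - 1)) ^ s"
    by (auto intro!: bexI[rotated] simp: power_add power_mult)
qed (use assms beta_nz in auto)

lemma T_code_distance_high:
  assumes "coprime h m" "2 * h \<le> m" "l < m" "m - 1 - l < h"
  shows "(q - 1) * q ^ (m - 1 - l) + 1 \<le> min_distance (code_length q m) (T_code emb q m l lam \<beta>)"
proof (rule T_code_distance)
  let ?r = "m - 1 - l"
  have "inj_on (\<lambda>j. inverse ((\<beta> ^ (q ^ h - 1)) ^ j)) {..<code_length q m}"
    using progression_inj[of h] assms by (auto simp: inj_on_def)
  then show "inj_on (\<lambda>j. inverse (\<beta> ^ (q ^ h - 1)) ^ j) {..<code_length q m}"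
    by (simp add: power_inverse)
  fix s assume s: "s < (q - 1) * q ^ ?r"
  \<comment> \<open>The complement of an exponent in \<open>T_set q m l\<close> has digit sum
    \<open>q - 2 + (q - 1) * ?r\<close>, and the progression starts with the least integer of this
    kind. Complements correspond to inverse powers of \<open>\<beta>\<close>, hence the inverse
    ratio.\<close>
  let ?i = "(q - 1) * q ^ ?r - 1 + (q ^ h - 1) * s"
  have i: "wt q m ?i = q - 1 - 1 + (q - 1) * ?r" "?i < q ^ m"
    using wt_progression[of "q - 1" q ?r h s 0 "m - 2 * h"] assms s q by simp_all
  obtain p where p: "q = 2 + p"
    using le_Suc_ex[of 2 q] q by auto
  have "m = Suc (l + ?r)"
    using assms(3) by simp
  then have "(q - 1) * m = (q - 1) * l + (q - 1) * ?r + (q - 1)"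
    by (metis add_mult_distrib2 mult_Suc_right add.commute)
  moreover have "wt q m (q ^ m - 1 - ?i) + wt q m ?i = (q - 1) * m"
    using i(2) q by (intro wt_complement) auto
  ultimately have "wt q m (q ^ m - 1 - ?i) = 1 + (q - 1) * l"
    using i(1) p by simp
  then have mem: "q ^ m - 1 - ?i \<in> T_set q m l"
    using q by (simp add: T_set_conv)
  have "\<beta> ^ (q ^ m - 1 - ?i) * \<beta> ^ ?i = 1"
    using i(2) beta_order by (simp flip: power_add)
  then have "\<beta> ^ (q ^ m - 1 - ?i) = inverse (\<beta> ^ ?i)"
    by (metis inverse_unique mult.commute)
  also have "\<dots> = inverse (\<beta> ^ ((q - 1) * q ^ ?r - 1)) * inverse (\<beta> ^ (q ^ h - 1)) ^ s"
    by (simp only: power_add power_mult inverse_mult_distrib power_inverse)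
  finally show "\<exists>i\<in>T_set q m l. \<beta> ^ i =
      inverse (\<beta> ^ ((q - 1) * q ^ ?r - 1)) * inverse (\<beta> ^ (q ^ h - 1)) ^ s"
    using mem by blast
qed (use assms beta_nz in auto)

text \<open>One zero already suffices. This serves \<open>m = 2\<close>, where the exponent (m-4)/2
  is negative and the required bound is below 2.\<close>

lemma T_code_distance_2:
  assumes "l < m"
  shows "2 \<le> min_distance (code_length q m) (T_code emb q m l lam \<beta>)"
proof -
  have "code_length q m \<le> q ^ m - 1"
    by (simp add: code_length_def)
  then have "inj_on (\<lambda>j. \<beta> ^ j) {..<code_length q m}"
    by (intro inj_on_subset[OF beta_inj]) auto
  then have "1 + 1 \<le> min_distance (code_length q m) (T_code emb q m l lam \<beta>)"
    using least_in_T_set[OF q assms] assms beta_nz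
    by (intro T_code_distance[where x = "\<beta> ^ (2 * q ^ l - 1)" and y = \<beta>]) auto
  then show ?thesis
    by simp
qed

text \<open>With \<open>e = 2 * (q^l - 1) / (q - 1)\<close> one has
  \<open>1 + (q - 1) * e = 2 * q ^ l - 1\<close>, the least element of \<open>T_set q m l\<close>.
  The run consists of \<open>1 + (q - 1) * k\<close> for \<open>0 \<le> k < e\<close>, with too
  small a digit sum, and \<open>1 - (q - 1) * k\<close> for
  \<open>1 \<le> k < q ^ (m - 1 - l)\<close>, with too large a one. It has
  \<open>q ^ (m - 1 - l) + e - 1\<close> members.\<close>

lemma dual_T_code_distance:
  assumes "l < m"
  shows "q ^ (m - 1 - l) + 2 * code_length q l
    \<le> min_distance (code_length q m) (dual_code (code_length q m) (T_code emb q m l lam \<beta>))"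
proof (rule min_distance_ge[OF linear_dual_T_code])
  let ?D = "dual_code (code_length q m) (T_code emb q m l lam \<beta>)"
  let ?r = "m - 1 - l" and ?e = "2 * code_length q l" and ?N = "q ^ m - 1"
  have "T_set q m l \<noteq> {}"
    using least_in_T_set[OF q assms] by blast
  then show "\<exists>v\<in>?D. v \<noteq> (\<lambda>_. 0)"
    by (intro nontrivial_if_card[OF linear_dual_T_code card_dual_T_code[OF assms]])
      (simp add: card_gt_0_iff)
  have e: "(q - 1) * ?e = 2 * (q ^ l - 1)"
    using code_length_mult[of q l] q by simp
  have r: "q ^ ?r > 0"
    using q by simp
  define y where "y = \<beta> ^ (q - 1)"
  \<comment> \<open>\<open>x\<close> belongs to the top exponent
    \<open>1 + (q - 1) * (?e - 1)\<close> of the run. The form with \<open>inverse y\<close> also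
    makes sense for \<open>l = 0\<close>, where \<open>?e = 0\<close>.\<close>
  define x where "x = y ^ ?e * \<beta> * inverse y"
  have y: "y \<noteq> 0"
    using beta_nz by (simp add: y_def)
  fix v assume v: "v \<in> ?D" "v \<noteq> (\<lambda>_. 0)"
  have zero: "(\<Sum>j<code_length q m. emb (v j) * inverse (\<beta> ^ i) ^ j) = 0"
    if i: "i = 1 + (q - 1) * k" "i < ?N" "i \<notin> T_set q m l" for i k
  proof (rule dual_poly_code_zero[OF emb length_pos T_poly_dvd])
    show "(\<beta> ^ i) ^ code_length q m = emb lam"
      using beta_power_length[of k] i(1) by simp
    show "\<beta> ^ i \<noteq> 0"
      using beta_nz by simp
    show "poly (map_poly emb (T_poly emb q m l \<beta>)) (\<beta> ^ i) \<noteq> 0"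
      using i(2,3) beta_power_eq_iff[of i] by (auto simp: map_T_poly poly_prod T_set_def)
    show "v \<in> dual_code (code_length q m) (poly_code (code_length q m) (T_poly emb q m l \<beta>))"
      using v(1) by (simp add: T_code_eq)
  qed
  have "q ^ ?r + ?e - 1 + 1 \<le> card {j. j < code_length q m \<and> v j \<noteq> 0}"
  proof (rule bch_bound[OF emb _ _ _ _ v(2)])
    show "v \<in> words (code_length q m)"
      using v(1) by (simp add: dual_code_def)
    show "inverse x \<noteq> 0"
      using beta_nz y by (simp add: x_def)
    show "inj_on (\<lambda>j. y ^ j) {..<code_length q m}"
    proof (rule inj_onI)
      fix j j' assume j: "j \<in> {..<code_length q m}" "j' \<in> {..<code_length q m}" and eq: "y ^ j = y ^ j'"
      have "(q - 1) * j < ?N" "(q - 1) * j' < ?N"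
        unfolding mult_less_period_iff using j by simp_all
      then have "(q - 1) * j = (q - 1) * j'"
        using eq beta_power_eq_iff by (simp add: y_def flip: power_mult)
      then show "j = j'"
        using q by simp
    qed
    fix s assume s: "s < q ^ ?r + ?e - 1"
    show "(\<Sum>j<code_length q m. emb (v j) * (inverse x * y ^ s) ^ j) = 0"
    proof (cases "s < ?e")
      case True
      define k where "k = ?e - 1 - s"
      have k: "?e = k + 1 + s"
        using True by (simp add: k_def)
      let ?i = "1 + (q - 1) * k"
      have "(q - 1) * k + (q - 1) \<le> (q - 1) * ?e"
        by (simp add: k distrib_left del: One_nat_def)
      then have less: "?i + 1 < 2 * q ^ l"
        using e q by simp
      moreover have "2 * q ^ l \<le> q ^ m"
        using mult_power_le[of 2 q l m] q assms by simp
      ultimately have "?i < ?N"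
        by simp
      moreover have "wt q m ?i < 1 + (q - 1) * l"
        using wt_less[of 2 q ?i l m] less q by simp
      then have "?i \<notin> T_set q m l"
        by (simp add: T_set_def)
      ultimately have "(\<Sum>j<code_length q m. emb (v j) * inverse (\<beta> ^ ?i) ^ j) = 0"
        by (intro zero) auto
      moreover have "x = \<beta> ^ ?i * y ^ s"
        unfolding x_def k using y by (simp add: power_add y_def mult_ac flip: power_mult)
      then have "inverse (\<beta> ^ ?i) = inverse x * y ^ s"
        using y beta_nz by (simp add: field_simps)
      ultimately show ?thesis
        by simp
    next
      case False
      \<comment> \<open>From here on the exponent is \<open>1 - (q - 1) * k\<close>, which is
        negative. Modulo \<open>q ^ m - 1\<close> it is \<open>1 + (q - 1) * b\<close> with
        \<open>b = code_length q m - k\<close>; the bounds on powers of \<open>q\<close> below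
        ensure that \<open>b\<close> is a natural number.\<close>
      define k where "k = s - ?e + 1"
      have k: "s + 1 = ?e + k" "1 \<le> k" "k < q ^ ?r"
        using False s by (auto simp: k_def)
      have "q ^ ?r \<le> q ^ (m - 1)"
        using q by (intro power_increasing) auto
      moreover have "q ^ (m - 1) \<le> code_length q m"
      proof -
        have "q ^ m = q * q ^ (m - 1)"
          using m by (cases m) auto
        then have "(q - 1) * q ^ (m - 1) = q ^ m - q ^ (m - 1)"
          by (simp add: diff_mult_distrib)
        also have "\<dots> \<le> (q - 1) * code_length q m"
          unfolding length_mult using q by (intro diff_le_mono2) simp
        finally show ?thesis
          using q by simp
      qed
      ultimately obtain b where b: "code_length q m = k + b"
        using k(3) by (metis le_add_diff_inverse less_imp_le order.strict_trans2)
      let ?i = "1 + (q - 1) * b"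
      have N: "?N = (q - 1) * k + (q - 1) * b"
        using code_length_mult[of q m] q by (simp add: b algebra_simps)
      have "(q - 1) * 1 \<le> (q - 1) * k"
        using k(2) by (intro mult_le_mono2)
      then have qk: "(q - 1) * k \<ge> 2"
        using q unfolding mult_1_right by linarith
      then have i: "?i < ?N"
        unfolding N by simp
      \<comment> \<open>The complement is smaller than \<open>(q - 1) * q ^ ?r - 1\<close>, so its
        digit sum is too small, which makes that of \<open>?i\<close> larger than
        \<open>1 + (q - 1) * l\<close>.\<close>
      have "?N - ?i = (q - 1) * k - 1"
        unfolding N by simp
      moreover have "(q - 1) * k < (q - 1) * q ^ ?r"
        using k(3) q by simp
      then have "(q - 1) * k - 1 + 1 < (q - 1) * q ^ ?r"
        using qk by linarith
      ultimately have "wt q m (?N - ?i) < q - 1 - 1 + (q - 1) * ?r"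
        using wt_less[of "q - 1" q "?N - ?i" ?r m] q by simp
      moreover have "wt q m (?N - ?i) + wt q m ?i = (q - 1) * m"
        using i q by (intro wt_complement) auto
      moreover have "(q - 1) * m = (q - 1) * l + (q - 1) * ?r + (q - 1)"
      proof -
        have "m = l + ?r + 1"
          using assms by simp
        then have "(q - 1) * m = (q - 1) * (l + ?r + 1)"
          by (rule arg_cong)
        then show ?thesis
          by (simp only: distrib_left mult_1_right)
      qed
      ultimately have "wt q m ?i \<noteq> 1 + (q - 1) * l"
        using q by linarith
      then have "?i \<notin> T_set q m l"
        by (simp add: T_set_def)
      then have "(\<Sum>j<code_length q m. emb (v j) * inverse (\<beta> ^ ?i) ^ j) = 0"
        using i by (intro zero) auto
      moreover have "inverse (\<beta> ^ ?i) = inverse x * y ^ s"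
      proof -
        have "\<beta> ^ ?i * y ^ k = \<beta> * \<beta> ^ ((q - 1) * k + (q - 1) * b)"
          by (simp add: y_def power_add mult_ac flip: power_mult)
        also have "\<dots> = \<beta>"
          unfolding N[symmetric] by (simp only: beta_order mult_1_right)
        finally have "\<beta> ^ ?i * y ^ k = \<beta>" .
        moreover have "y ^ s * y = y ^ (s + 1)"
          by simp
        then have "y ^ s * y = y ^ ?e * y ^ k"
          by (simp only: k(1) power_add)
        ultimately have "\<beta> ^ ?i * (y ^ s * y) = y ^ ?e * \<beta>"
          by (metis mult.left_commute)
        then have "\<beta> ^ ?i * y ^ s = x"
          using y by (simp add: x_def field_simps)
        then show ?thesis
          using y beta_nz by (auto simp: field_simps)
      qed
      ultimately show ?thesis
        by simp
    qed
  qed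
  then show "q ^ ?r + ?e \<le> card {j. j < code_length q m \<and> v j \<noteq> 0}"
    using r by simp
qed

end

section \<open>The cases of the distance bound and the theorem\<close>

text \<open>In terms of \<open>h\<close> the case distinction becomes that between
  \<open>l < h\<close>, \<open>h \<le> l < m - h\<close> and \<open>l \<ge> m - h\<close>, on which
  the three progressions are based. The same holds for the other residues of \<open>m\<close>
  below.\<close>

lemma dist_bound_odd:
  assumes "m = 2 * h + 1"
  shows "dist_bound q m l = (if l < h then 2 * real q ^ l + 1 else if l = h then real q ^ h + 1
    else (real q - 1) * real q powi (int m - 1 - int l) + 1)"
proof -
  have "(int m - 3) div 2 = int h - 1" "(int m - 1) div 2 = int h" "odd m" "m mod 4 \<noteq> 0" "m mod 4 \<noteq> 2"
    using assms by (simp_all, presburger+)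
  then show ?thesis
    by (simp add: dist_bound_def Let_def)
qed

lemma dist_bound_0_mod_4:
  assumes "m = 2 * h + 2" "odd h"
  shows "dist_bound q m l = (if l < h then 2 * real q ^ l + 1
    else if l = h \<or> l = h + 1 then real q ^ h + 1
    else (real q - 1) * real q powi (int m - 1 - int l) + 1)"
proof -
  have "(int m - 4) div 2 = int h - 1" "(int m - 2) div 2 = int h" "int m div 2 = int (h + 1)"
    "even m" "m mod 4 = 0"
    using assms by (simp_all, presburger+)
  moreover have "real q powi (int (Suc h) - 1) = real q ^ h"
    by simp
  ultimately show ?thesis
    by (auto simp add: dist_bound_def Let_def simp del: of_nat_add of_nat_Suc)
qed

lemma dist_bound_2_mod_4:
  assumes "m = 2 * h + 4" "odd h"
  shows "dist_bound q m l = (if l < h then 2 * real q ^ l + 1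
    else if l \<le> h + 3 then real q ^ h + 1
    else (real q - 1) * real q powi (int m - 1 - int l) + 1)"
proof -
  have "(int m - 6) div 2 = int h - 1" "(int m - 4) div 2 = int h" "(int m + 2) div 2 = int (h + 3)"
    "even m" "m mod 4 = 2"
    using assms by (simp_all, presburger+)
  then show ?thesis
    by (auto simp add: dist_bound_def Let_def simp del: of_nat_add of_nat_Suc)
qed

lemma dist_bound_2: "l \<le> 1 \<Longrightarrow> dist_bound q 2 l = 1 / real q + 1"
  by (simp add: dist_bound_def Let_def power_int_minus field_simps)

theorem theorem25:
  fixes q m l :: nat
    and emb :: "'a::finite_field \<Rightarrow> 'b::finite_field"
    and lam :: 'a and \<beta> :: 'b
  assumes "q > 2" and "m \<ge> 2" and "l \<le> m - 1"
    and "card (UNIV :: 'a set) = q" and "card (UNIV :: 'b set) = q ^ m"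
    and "field_embedding emb"
    and "primitive_element lam" and "primitive_element \<beta>"
    and "\<beta> ^ code_length q m = emb lam"
  shows "map_poly emb (T_poly emb q m l \<beta>) = (\<Prod>i\<in>T_set q m l. [:- (\<beta> ^ i), 1:]) \<and>
    constacyclic_code (code_length q m) lam (T_code emb q m l lam \<beta>) \<and>
    generator_poly (code_length q m) lam (T_code emb q m l lam \<beta>) (T_poly emb q m l \<beta>) \<and>
    int (code_dim (T_code emb q m l lam \<beta>)) = int (code_length q m) - T_count q m l \<and>
    real (min_distance (code_length q m) (T_code emb q m l lam \<beta>)) \<ge> dist_bound q m l \<and>
    constacyclic_code (code_length q m) (inverse lam)
      (dual_code (code_length q m) (T_code emb q m l lam \<beta>)) \<and>
    int (code_dim (dual_code (code_length q m) (T_code emb q m l lam \<beta>))) = T_count q m l \<and>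
    real (min_distance (code_length q m)
      (dual_code (code_length q m) (T_code emb q m l lam \<beta>))) \<ge> dual_dist_bound q m l"
proof -
  note hyps = assms(1,2,4-9)
  let ?n = "code_length q m" and ?C = "T_code emb q m l lam \<beta>" and ?g = "T_poly emb q m l \<beta>"
  let ?d = "min_distance ?n ?C"
  have l: "l < m"
    using assms(2,3) by simp
  note n = length_pos[OF hyps] and lam = lam_nz[OF hyps] and dvd = T_poly_dvd[OF hyps, of l]
    and C = T_code_eq[OF hyps, of l] and less = card_T_set_less[OF hyps l]
    and count = card_T_set[of q m l]
  have "code_dim ?C = ?n - card (T_set q m l)"
    by (rule code_dim_eqI[OF linear_T_code[OF hyps]])
      (simp add: card_T_code[OF hyps l] assms(4))
  then have dim: "int (code_dim ?C) = int ?n - T_count q m l"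
    using less count assms(1,2) by (simp add: of_nat_diff)
  have "code_dim (dual_code ?n ?C) = card (T_set q m l)"
    by (rule code_dim_eqI[OF linear_dual_T_code[OF hyps]])
      (simp add: card_dual_T_code[OF hyps l] assms(4))
  then have dual_dim: "int (code_dim (dual_code ?n ?C)) = T_count q m l"
    using count assms(1,2) by simp
  have low: "2 * real q ^ l + 1 \<le> real ?d" if "coprime h m" "2 * h \<le> m" "l < h" for h
    using of_nat_mono[where ?'a = real, OF T_code_distance_low[OF hyps that]] by simp
  have middle: "real q ^ h + 1 \<le> real ?d" if "coprime h m" "h > 0" "h \<le> l" "l < m - h" for h
    using of_nat_mono[where ?'a = real, OF T_code_distance_middle[OF hyps that]] by simp
  have powi: "real q powi (int m - 1 - int l) = real q ^ (m - 1 - l)"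
  proof -
    have "int m - 1 - int l = int (m - 1 - l)"
      using l by simp
    then show ?thesis
      by (simp only: power_int_of_nat)
  qed
  have high: "(real q - 1) * real q powi (int m - 1 - int l) + 1 \<le> real ?d"
    if "coprime h m" "2 * h \<le> m" "m - 1 - l < h" for h
    using of_nat_mono[where ?'a = real, OF T_code_distance_high[OF hyps that(1,2) l that(3)]]
      assms(1) by (simp add: powi of_nat_diff)
  have dist: "dist_bound q m l \<le> real ?d"
  proof -
    consider (odd) h where "m = 2 * h + 1" | (two) "m = 2"
      | (mod0) h where "m = 2 * h + 2" "odd h" | (mod2) h where "m = 2 * h + 4" "odd h"
    proof (cases "odd m \<or> m = 2")
      case False
      then have "m \<ge> 4" "even m"
        using assms(2) by presburger+
      then obtain k where k: "m = 2 * k + 4"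
        by (metis le_Suc_ex even_add evenE even_numeral add.commute)
      show thesis
      proof (cases "odd k")
        case True
        then show thesis
          using that(4) k by blast
      next
        case False
        then show thesis
          using that(3)[of "k + 1"] k by simp
      qed
    qed (use that(1,2) in \<open>auto elim: oddE\<close>)
    then show ?thesis
    proof cases
      case (odd h)
      have "coprime h m"
        unfolding odd by (simp only: coprime_iff_gcd_eq_1 gcd_add_mult) simp
      then show ?thesis
        unfolding dist_bound_odd[OF odd] using low[of h] middle[of h] high[of h] odd assms(2) l by auto
    next
      case (mod0 h)
      have "coprime h 2"
        using mod0(2) by simp
      then have "coprime h m"
        unfolding mod0(1) by (metis coprime_iff_gcd_eq_1 gcd_add_mult mult.commute)
      moreover have "h > 0"
        using mod0(2) by (intro gr0I) auto
      ultimately show ?thesis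
        unfolding dist_bound_0_mod_4[OF mod0]
        using low[of h] middle[of h] high[of h] mod0(1) l by auto
    next
      case (mod2 h)
      \<comment> \<open>Since \<open>m = 2 * h + 4\<close>, the common divisors of \<open>h\<close>
        and \<open>m\<close> are those of \<open>h\<close> and 4, and \<open>h\<close> is
        odd.\<close>
      have "coprime h (2 ^ 2)"
        using mod2(2) by (simp only: coprime_power_right_iff) simp
      then have "coprime h 4"
        by simp
      then have "coprime h m"
        unfolding mod2(1) by (metis coprime_iff_gcd_eq_1 gcd_add_mult mult.commute)
      moreover have "h > 0"
        using mod2(2) by (intro gr0I) auto
      ultimately show ?thesis
        unfolding dist_bound_2_mod_4[OF mod2]
        using low[of h] middle[of h] high[of h] mod2(1) l by auto
    next
      case two
      have "1 / real q + 1 \<le> 2"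
        using assms(1) by (simp add: field_simps)
      also have "2 \<le> real ?d"
        using T_code_distance_2[OF hyps l] by simp
      finally show ?thesis
        using dist_bound_2[of l q] l two by simp
    qed
  qed
  have "real (q - 1) * real (code_length q l) = real (q ^ l - 1)"
    using code_length_mult[of q l] assms(1) by (metis of_nat_mult gr_implies_not0 gr0I)
  then have "real (code_length q l) = (real q ^ l - 1) / (real q - 1)"
    using assms(1) by (simp add: of_nat_diff field_simps)
  then have "dual_dist_bound q m l = real (q ^ (m - 1 - l) + 2 * code_length q l)"
    by (simp add: dual_dist_bound_def powi)
  then have dual_dist: "dual_dist_bound q m l \<le> real (min_distance ?n (dual_code ?n ?C))"
    using dual_T_code_distance[OF hyps l] by (simp only: of_nat_le_iff)
  show ?thesis
    using map_T_poly[OF hyps] constacyclic_poly_code[OF n lam dvd]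
      generator_poly_poly_code[OF n lam dvd lead_coeff_T_poly[OF hyps]]
      constacyclic_dual_poly_code[OF n lam dvd] dim dist dual_dim dual_dist
    unfolding C by blast
qed

end
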